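(* There is an absolute constant $c>0$ such that the following holds for every integer $n\ge 2$ and every $\varepsilon$ with $0<\varepsilon<1/n^4$. Let $\mathcal{P}'$ be a deterministic cuts-only primitive protocol that is fair (proportional) on every instance of $\mathcal{J}$. Then the expected number of queries made by $\mathcal{P}'$, when the instance is drawn from the uniform distribution $\mathcal{D}$ on $\mathcal{J}$, is at least $c\,n\log n$.
   Context: The cake is $[0,1]$, with $n$ players $p\in\{1,\dots,n\}$. For $i\in\{1,\dots,n\}$ let $X_i=\{\,i/(n+1)+k\varepsilon : k=1,\dots,n\,\}$, and call $i/(n+1)+k\varepsilon$ the $k$-th point of $X_i$. A WS instance is specified by points $x_{p,i}\in X_i$ ($p,i\in\{1,\dots,n\}$) such that for each $i$ the map $p\mapsto x_{p,i}$ is a bijection from $\{1,\dots,n\}$ onto $X_i$. In this instance, player $p$'s measure $\mu_p$ is the measure on $[0,1]$ that puts mass $1/(n+1)$ uniformly on $[0,\varepsilon/2]$ and, for each $i\in\{1,\dots,n\}$, mass $i/(n^2+n)$ uniformly on $[x_{p,i}-\varepsilon/2,\,x_{p,i}]$ and mass $(n-i)/(n^2+n)$ uniformly on $[x_{p,i},\,x_{p,i}+\varepsilon/2]$, and no other mass; then $\mu_p([0,1])=1$ and the $i/n$-point of $p$ (the infimum of $x$ with $\mu_p([0,x])=i/n$) is $x_{p,i}$. Queries: $\mathrm{Cut}(p,\alpha)$ returns the $\alpha$-point of $p$; $\mathrm{Eval}(p,x)$ returns $\mu_p([0,x])$, allowed only if $x$ was returned by an earlier Cut. A deterministic protocol issues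 queries adaptively (each query a function of previous answers) and terminates by assigning to each player a single interval $[a,b)$ whose endpoints are $0$, $1$, or values returned by earlier Cut queries, the intervals being pairwise disjoint (Woeginger–Sgall restricted model). It is fair on an instance if every player $p$ receives an interval of $\mu_p$-value at least $1/n$. A protocol is primitive if all its Cut queries are of the form $\mathrm{Cut}(p,i/n)$ with $i\in\{1,\dots,n\}$, and cuts-only if it makes no Eval queries. For a permutation $\pi$ of $\{1,\dots,n\}$, let $\mathcal{J}_\pi$ be the set of WS instances such that for all $p,i$: if $\pi(p)=i$ then $x_{p,i}$ is the $i$-th point of $X_i$; if $\pi(p)<i$ then $x_{p,i}$ is one of the first $i-1$ points of $X_i$; if $\pi(p)>i$ then $x_{p,i}$ is one of the last $n-i$ points of $X_i$. Let $\mathcal{J}=\bigcup_\pi\mathcal{J}_\pi$ (each instance lies in exactly one $\mathcal{J}_\pi$; $\pi$ is its underlying permutation) and $\mathcal{D}$ the uniform distribution on the finite set $\mathcal{J}$. *)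

theory Defs
  imports "HOL-Probability.Probability" "HOL-Combinatorics.Permutations"
begin

section \<open>Protocols in the Woeginger--Sgall model\<close>

text \<open>
  Players are the numbers \<open>1, \<dots>, n\<close>; a valuation profile is a function \<open>\<mu> :: nat \<Rightarrow> real measure\<close>.
  The measures live on \<open>borel\<close> but are concentrated on the cake \<open>[0,1]\<close>.
\<close>

datatype query = Cut nat real | Eval nat real

datatype action = Query query | Allocate "nat \<Rightarrow> real \<times> real"

text \<open>The next action is a function of the list of answers received so far (oldest first).\<close>

type_synonym protocol = "real list \<Rightarrow> action"

definition quantile_point :: "real measure \<Rightarrow> real \<Rightarrow> real" where
  "quantile_point M \<alpha> = Inf {x \<in> {0..1}. measure M {0..x} = \<alpha>}"

fun answer :: "(nat \<Rightarrow> real measure) \<Rightarrow> query \<Rightarrow> real" where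
  "answer \<mu> (Cut p \<alpha>) = quantile_point (\<mu> p) \<alpha>"
| "answer \<mu> (Eval p x) = measure (\<mu> p) {0..x}"

text \<open>
  The first \<open>k\<close> queries of the run on \<open>\<mu>\<close> together with their answers; the transcript stops
  growing once the protocol allocates.
\<close>

fun transcript :: "(nat \<Rightarrow> real measure) \<Rightarrow> protocol \<Rightarrow> nat \<Rightarrow> (query \<times> real) list" where
  "transcript \<mu> P 0 = []"
| "transcript \<mu> P (Suc k) =
     (let h = transcript \<mu> P k in
      case P (map snd h) of
        Query q \<Rightarrow> h @ [(q, answer \<mu> q)]
      | Allocate A \<Rightarrow> h)"

definition next_action :: "(nat \<Rightarrow> real measure) \<Rightarrow> protocol \<Rightarrow> nat \<Rightarrow> action" where
  "next_action \<mu> P k = P (map snd (transcript \<mu> P k))"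

definition terminates_on :: "(nat \<Rightarrow> real measure) \<Rightarrow> protocol \<Rightarrow> bool" where
  "terminates_on \<mu> P \<longleftrightarrow> (\<exists>k A. next_action \<mu> P k = Allocate A)"

definition num_queries :: "(nat \<Rightarrow> real measure) \<Rightarrow> protocol \<Rightarrow> nat" where
  "num_queries \<mu> P = (LEAST k. \<exists>A. next_action \<mu> P k = Allocate A)"

definition cut_values :: "(query \<times> real) list \<Rightarrow> real set" where
  "cut_values h = {x. \<exists>p \<alpha>. (Cut p \<alpha>, x) \<in> set h}"

definition interval_of :: "(nat \<Rightarrow> real \<times> real) \<Rightarrow> nat \<Rightarrow> real set" where
  "interval_of A p = {fst (A p)..<snd (A p)}"

fun legal_action :: "nat \<Rightarrow> (query \<times> real) list \<Rightarrow> action \<Rightarrow> bool" where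
  "legal_action n h (Query (Cut p \<alpha>)) \<longleftrightarrow> p \<in> {1..n} \<and> \<alpha> \<in> {0..1}"
| "legal_action n h (Query (Eval p x)) \<longleftrightarrow> p \<in> {1..n} \<and> x \<in> cut_values h"
| "legal_action n h (Allocate A) \<longleftrightarrow>
     (\<forall>p\<in>{1..n}. fst (A p) \<in> {0, 1} \<union> cut_values h \<and> snd (A p) \<in> {0, 1} \<union> cut_values h) \<and>
     disjoint_family_on (interval_of A) {1..n}"

text \<open>
  All properties of a protocol are stated for its run on a given profile, so nothing is required
  of its behaviour on answer sequences that do not arise.
\<close>

definition valid_on :: "nat \<Rightarrow> (nat \<Rightarrow> real measure) \<Rightarrow> protocol \<Rightarrow> bool" where
  "valid_on n \<mu> P \<longleftrightarrow>
     terminates_on \<mu> P \<and> (\<forall>k. legal_action n (transcript \<mu> P k) (next_action \<mu> P k))"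

definition cuts_only_on :: "(nat \<Rightarrow> real measure) \<Rightarrow> protocol \<Rightarrow> bool" where
  "cuts_only_on \<mu> P \<longleftrightarrow> (\<forall>k p x. next_action \<mu> P k \<noteq> Query (Eval p x))"

definition primitive_on :: "nat \<Rightarrow> (nat \<Rightarrow> real measure) \<Rightarrow> protocol \<Rightarrow> bool" where
  "primitive_on n \<mu> P \<longleftrightarrow>
     (\<forall>k p \<alpha>. next_action \<mu> P k = Query (Cut p \<alpha>) \<longrightarrow> (\<exists>i\<in>{1..n}. \<alpha> = real i / real n))"

definition fair_on :: "nat \<Rightarrow> (nat \<Rightarrow> real measure) \<Rightarrow> protocol \<Rightarrow> bool" where
  "fair_on n \<mu> P \<longleftrightarrow>
     (\<exists>k A. next_action \<mu> P k = Allocate A \<and>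
            (\<forall>p\<in>{1..n}. measure (\<mu> p) (interval_of A p) \<ge> 1 / real n))"


section \<open>Woeginger--Sgall instances\<close>

definition kth_point :: "nat \<Rightarrow> real \<Rightarrow> nat \<Rightarrow> nat \<Rightarrow> real" where
  "kth_point n \<epsilon> i k = real i / (real n + 1) + real k * \<epsilon>"

definition X :: "nat \<Rightarrow> real \<Rightarrow> nat \<Rightarrow> real set" where
  "X n \<epsilon> i = kth_point n \<epsilon> i ` {1..n}"

text \<open>
  An instance is the family \<open>x p i\<close>, taken extensional in both arguments so that each instance is
  represented by exactly one function.
\<close>

definition WS_instances :: "nat \<Rightarrow> real \<Rightarrow> (nat \<Rightarrow> nat \<Rightarrow> real) set" where
  "WS_instances n \<epsilon> =
     {x \<in> {1..n} \<rightarrow>\<^sub>E (\<Pi>\<^sub>E i\<in>{1..n}. X n \<epsilon> i).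
        \<forall>i\<in>{1..n}. bij_betw (\<lambda>p. x p i) {1..n} (X n \<epsilon> i)}"

definition unif_density :: "real \<Rightarrow> real \<Rightarrow> real \<Rightarrow> real" where
  "unif_density a b t = indicator {a..b} t / (b - a)"

definition WS_measure :: "nat \<Rightarrow> real \<Rightarrow> (nat \<Rightarrow> nat \<Rightarrow> real) \<Rightarrow> nat \<Rightarrow> real measure" where
  "WS_measure n \<epsilon> x p = density lborel (\<lambda>t. ennreal (
     1 / (real n + 1) * unif_density 0 (\<epsilon> / 2) t +
     (\<Sum>i=1..n.
        real i / (real n ^ 2 + real n) * unif_density (x p i - \<epsilon> / 2) (x p i) t +
        (real n - real i) / (real n ^ 2 + real n) * unif_density (x p i) (x p i + \<epsilon> / 2) t)))"

definition J_perm :: "nat \<Rightarrow> real \<Rightarrow> (nat \<Rightarrow> nat) \<Rightarrow> (nat \<Rightarrow> nat \<Rightarrow> real) set" where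
  "J_perm n \<epsilon> \<pi> =
     {x \<in> WS_instances n \<epsilon>. \<forall>p\<in>{1..n}. \<forall>i\<in>{1..n}.
        (\<pi> p = i \<longrightarrow> x p i = kth_point n \<epsilon> i i) \<and>
        (\<pi> p < i \<longrightarrow> x p i \<in> kth_point n \<epsilon> i ` {1..i - 1}) \<and>
        (\<pi> p > i \<longrightarrow> x p i \<in> kth_point n \<epsilon> i ` {i + 1..n})}"

definition J :: "nat \<Rightarrow> real \<Rightarrow> (nat \<Rightarrow> nat \<Rightarrow> real) set" where
  "J n \<epsilon> = (\<Union>\<pi>\<in>{\<pi>. \<pi> permutes {1..n}}. J_perm n \<epsilon> \<pi>)"

definition D :: "nat \<Rightarrow> real \<Rightarrow> (nat \<Rightarrow> nat \<Rightarrow> real) pmf" where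
  "D n \<epsilon> = pmf_of_set (J n \<epsilon>)"

end

theory Submission
  imports Defs
begin

text \<open>
  In \<open>\<mu>\<^sub>p\<close> every group \<open>X\<^sub>i\<close> carries mass \<open>1 / (n + 1) < 1 / n\<close>, so a fair allocation gives each player a
  slot reaching from one group to the next, and the order of the players' points at the borders
  between slots forces player \<open>p\<close> to own slot \<open>\<pi> p\<close>. Hence the transcript determines \<open>\<pi>\<close>. A query
  \<open>Cut(p, i/n)\<close> only reveals how \<open>\<pi> p\<close> compares with \<open>i\<close>: the rank inside \<open>X\<^sub>i\<close> is independent of \<open>\<pi>\<close> given
  this comparison. So the protocol behaves like a ternary decision tree with \<open>n!\<close> leaves, and
  Kraft's inequality yields the average depth \<open>log\<^sub>3 n!\<close>.
\<close>

section \<open>Masses of intervals\<close>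

text \<open>The obstacle is that one answer can take up to n values, so counting the leaves of the
  protocol tree directly loses a factor of order log n. Instead each node gets a potential: the
  number of ways to complete the revealed values under one fixed compatible permutation. The answers
  on one side of the middle point of X_i share the potential of the node among themselves, so the
  potentials of all children add up to at most three times that of the node, however many children
  there are. At an allocation the surviving instances have one common permutation, and the potential
  bounds their number. Hence the sum of 3^(-queries) over \<open>J\<close> is at most the root
  potential, which is at most |J| / n!. Counting with inequalities in this way replaces conditional
  probabilities.\<close>

lemma has_bochner_integral_unif_density:
  assumes "A \<in> sets borel"
  shows "has_bochner_integral lborel (\<lambda>z. unif_density s t z * indicator A z)
           (measure lborel ({s..t} \<inter> A) / (t - s))"
proof -
  have fin: "emeasure lborel ({s..t} \<inter> A) < \<infinity>"
    using emeasure_mono[of "{s..t} \<inter> A" "{s..t}" lborel]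
    by (intro le_less_trans[OF emeasure_mono[of "{s..t} \<inter> A" "{s..t}"]])
       (auto simp: emeasure_lborel_Icc_eq)
  have "has_bochner_integral lborel (indicator ({s..t} \<inter> A) :: real \<Rightarrow> real)
          (measure lborel ({s..t} \<inter> A))"
    using assms fin by (intro has_bochner_integral_real_indicator) auto
  then have "has_bochner_integral lborel (\<lambda>z. indicator ({s..t} \<inter> A) z / (t - s))
          (measure lborel ({s..t} \<inter> A) / (t - s))"
    by (intro has_bochner_integral_divide) auto
  then show ?thesis
    by (simp add: unif_density_def indicator_inter_arith mult.commute)
qed

lemma measure_Icc_Int_le:
  assumes "A \<in> sets borel" "s \<le> t"
  shows "measure lborel ({s..t} \<inter> A) \<le> t - s"
proof -
  have "measure lborel ({s..t} \<inter> A) \<le> measure lborel {s..t}"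
    using assms by (intro measure_mono_fmeasurable) (auto simp: fmeasurable_def emeasure_lborel_Icc_eq)
  with assms show ?thesis by simp
qed

lemma measure_subset_singleton:
  assumes "A \<subseteq> {z :: real}"
  shows "measure lborel A = 0"
proof -
  have "A = {} \<or> A = {z}" using assms by auto
  then show ?thesis by auto
qed

locale ws_parameters =
  fixes n :: nat and \<epsilon> :: real
  assumes n2: "n \<ge> 2" and eps0: "\<epsilon> > 0" and eps1: "\<epsilon> < 1 / real n ^ 4"
begin

text \<open>Scale separation: a group reaches at most n \<epsilon> beyond its base i/(n+1), and a
  further \<epsilon> still fits before the next base. From n \<ge> 2 follows n + 1 \<le> n^2, whence
  (n+1)^2 \<le> n^4.\<close>

lemma n_eps1: "(real n + 1) * \<epsilon> < 1 / (real n + 1)"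
proof -
  have "real n + 1 \<le> real n * 2" using n2 by simp
  also have "\<dots> \<le> real n * real n" using n2 by (intro mult_left_mono) auto
  finally have sq: "(real n + 1) * (real n + 1) \<le> (real n * real n) * (real n * real n)"
    by (intro mult_mono) auto
  have "(real n + 1) * \<epsilon> < (real n + 1) * (1 / real n ^ 4)"
    using eps1 by (intro mult_strict_left_mono) auto
  also have "\<dots> \<le> 1 / (real n + 1)"
    using sq n2 by (simp add: divide_simps power_numeral_reduce mult.assoc)
  finally show ?thesis .
qed

lemma n_eps: "real n * \<epsilon> < 1 / (real n + 1)"
  using n_eps1 eps0 by (simp add: distrib_right)

lemma kth_point_less_iff: "kth_point n \<epsilon> i k < kth_point n \<epsilon> i l \<longleftrightarrow> k < l"
  using eps0 by (simp add: kth_point_def)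

lemma inj_kth_point: "inj (kth_point n \<epsilon> i)"
  using eps0 by (auto simp: inj_def kth_point_def)

text \<open>The mass of \<open>[0, \<epsilon>/2]\<close> is treated as a block of index \<open>0\<close> around \<open>0\<close>: for \<open>j = 0\<close> the
  left half of a block has weight \<open>0\<close>, and the right half has weight \<open>n / (n\<^sup>2 + n) = 1 / (n + 1)\<close>.\<close>

definition centre :: "(nat \<Rightarrow> nat \<Rightarrow> real) \<Rightarrow> nat \<Rightarrow> nat \<Rightarrow> real" where
  "centre x p j = (if j = 0 then 0 else x p j)"

definition block_mass :: "real \<Rightarrow> nat \<Rightarrow> real set \<Rightarrow> real" where
  "block_mass y j A =
     real j / (real n ^ 2 + real n) * (measure lborel ({y - \<epsilon> / 2..y} \<inter> A) / (\<epsilon> / 2)) +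
     (real n - real j) / (real n ^ 2 + real n) * (measure lborel ({y..y + \<epsilon> / 2} \<inter> A) / (\<epsilon> / 2))"

lemma measure_WS:
  assumes A: "A \<in> sets borel"
  shows "measure (WS_measure n \<epsilon> x p) A = (\<Sum>j\<in>{0..n}. block_mass (centre x p j) j A)"
proof -
  define f where "f = (\<lambda>t. 1 / (real n + 1) * unif_density 0 (\<epsilon> / 2) t +
     (\<Sum>i=1..n.
        real i / (real n ^ 2 + real n) * unif_density (x p i - \<epsilon> / 2) (x p i) t +
        (real n - real i) / (real n ^ 2 + real n) * unif_density (x p i) (x p i + \<epsilon> / 2) t))"
  define I where "I = 1 / (real n + 1) * (measure lborel ({0..\<epsilon>/2} \<inter> A) / (\<epsilon> / 2 - 0)) +
     (\<Sum>i=1..n.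
        real i / (real n ^ 2 + real n) * 
          (measure lborel ({x p i - \<epsilon> / 2..x p i} \<inter> A) / (x p i - (x p i - \<epsilon> / 2))) +
        (real n - real i) / (real n ^ 2 + real n) *
          (measure lborel ({x p i..x p i + \<epsilon> / 2} \<inter> A) / (x p i + \<epsilon> / 2 - x p i)))"
  have WS: "WS_measure n \<epsilon> x p = density lborel (\<lambda>t. ennreal (f t))"
    by (simp only: WS_measure_def f_def)
  have f0: "f z \<ge> 0" for z
    unfolding f_def unif_density_def using eps0
    by (intro add_nonneg_nonneg sum_nonneg mult_nonneg_nonneg) auto
  have fm: "f \<in> borel_measurable borel"
    unfolding f_def unif_density_def by measurable
  have "has_bochner_integral lborel (\<lambda>z. 1 / (real n + 1) * (unif_density 0 (\<epsilon> / 2) z * indicator A z) +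
     (\<Sum>i=1..n.
        real i / (real n ^ 2 + real n) * (unif_density (x p i - \<epsilon> / 2) (x p i) z * indicator A z) +
        (real n - real i) / (real n ^ 2 + real n) * (unif_density (x p i) (x p i + \<epsilon> / 2) z * indicator A z))) I"
    unfolding I_def
    by (intro has_bochner_integral_add has_bochner_integral_sum has_bochner_integral_mult_right
        has_bochner_integral_unif_density A)
  then have hb: "has_bochner_integral lborel (\<lambda>z. f z * indicator A z) I"
    unfolding f_def by (simp add: algebra_simps sum_distrib_left sum_distrib_right sum.distrib)
  have "emeasure (WS_measure n \<epsilon> x p) A = (\<integral>\<^sup>+z. ennreal (f z) * indicator A z \<partial>lborel)"
    using A fm by (subst WS) (simp add: emeasure_density)
  also have "\<dots> = (\<integral>\<^sup>+z. ennreal (f z * indicator A z) \<partial>lborel)"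
    by (intro nn_integral_cong) (auto split: split_indicator)
  also have "\<dots> = ennreal I"
    using hb f0 by (subst nn_integral_eq_integral)
      (auto simp: has_bochner_integral_iff split: split_indicator)
  finally have e: "emeasure (WS_measure n \<epsilon> x p) A = ennreal I" .
  have "I \<ge> 0"
    unfolding I_def using eps0 by (intro add_nonneg_nonneg sum_nonneg mult_nonneg_nonneg) auto
  with e have "measure (WS_measure n \<epsilon> x p) A = I"
    by (simp add: measure_def)
  also have "I = block_mass 0 0 A + (\<Sum>j=1..n. block_mass (x p j) j A)"
  proof -
    have "1 / (real n + 1) = real n / (real n ^ 2 + real n)"
    proof -
      have "real n ^ 2 + real n = real n * (real n + 1)" by (simp add: power2_eq_square algebra_simps)
      then show ?thesis using n2 by simp
    qed
    then show ?thesis by (simp add: I_def block_mass_def)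
  qed
  also have "\<dots> = (\<Sum>j\<in>{0..n}. block_mass (centre x p j) j A)"
    by (subst (2) sum.atLeast_Suc_atMost) (auto simp: centre_def intro!: sum.cong)
  finally show ?thesis .
qed

lemma block_weights: "real j / (real n ^ 2 + real n) + (real n - real j) / (real n ^ 2 + real n) = 1 / (real n + 1)"
proof -
  have "real n ^ 2 + real n = real n * (real n + 1)" by (simp add: power2_eq_square algebra_simps)
  then show ?thesis using n2 by (simp add: add_divide_distrib[symmetric])
qed

text \<open>Since 1/(n+1) < 1/n, no single block can satisfy a player.\<close>

lemma block_mass_bounds:
  assumes A: "A \<in> sets borel" and j: "j \<le> n"
  shows "0 \<le> block_mass y j A" "block_mass y j A \<le> 1 / (real n + 1)"
proof -
  show "0 \<le> block_mass y j A"
    using j eps0 by (auto simp: block_mass_def)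
  have le1: "measure lborel ({s..t} \<inter> A) / (\<epsilon> / 2) \<le> 1" if "t - s = \<epsilon> / 2" for s t
    using measure_Icc_Int_le[OF A, of s t] that eps0 by simp
  have "block_mass y j A \<le> real j / (real n ^ 2 + real n) * 1 + (real n - real j) / (real n ^ 2 + real n) * 1"
    unfolding block_mass_def
    using j by (intro add_mono mult_left_mono le1) auto
  then show "block_mass y j A \<le> 1 / (real n + 1)" using block_weights[of j] by simp
qed

text \<open>It is enough to avoid the open block: what remains of each half is at most its outer
  endpoint, a null set.\<close>

lemma block_mass_eq_0:
  assumes "A \<inter> {y - \<epsilon> / 2<..<y + \<epsilon> / 2} = {}"
  shows "block_mass y j A = 0"
proof -
  have "z = y - \<epsilon> / 2" if "z \<in> {y - \<epsilon> / 2..y} \<inter> A" for z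
  proof (rule ccontr)
    assume "z \<noteq> y - \<epsilon> / 2"
    with that eps0 have "z \<in> A \<inter> {y - \<epsilon> / 2<..<y + \<epsilon> / 2}" by auto
    with assms show False by blast
  qed
  moreover have "z = y + \<epsilon> / 2" if "z \<in> {y..y + \<epsilon> / 2} \<inter> A" for z
  proof (rule ccontr)
    assume "z \<noteq> y + \<epsilon> / 2"
    with that eps0 have "z \<in> A \<inter> {y - \<epsilon> / 2<..<y + \<epsilon> / 2}" by auto
    with assms show False by blast
  qed
  ultimately have "{y - \<epsilon> / 2..y} \<inter> A \<subseteq> {y - \<epsilon> / 2}" "{y..y + \<epsilon> / 2} \<inter> A \<subseteq> {y + \<epsilon> / 2}"
    by blast+
  note this[THEN measure_subset_singleton]
  then show ?thesis by (simp add: block_mass_def)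
qed

text \<open>The second alternative serves block 0, whose left half sticks out of the cake but has
  weight 0.\<close>

lemma block_mass_full:
  assumes "{y - \<epsilon> / 2..y + \<epsilon> / 2} \<subseteq> A \<or> j = 0 \<and> {y..y + \<epsilon> / 2} \<subseteq> A"
  shows "block_mass y j A = 1 / (real n + 1)"
proof -
  have "{y..y + \<epsilon> / 2} \<inter> A = {y..y + \<epsilon> / 2}" using assms eps0 by auto
  moreover have "j = 0 \<or> {y - \<epsilon> / 2..y} \<inter> A = {y - \<epsilon> / 2..y}" using assms eps0 by auto
  ultimately show ?thesis using block_weights[of j] eps0 by (auto simp: block_mass_def)
qed

text \<open>A cell (p, i) stands for the fact revealed by \<open>Cut p (i / n)\<close>.\<close>

definition cells :: "(nat \<times> nat) set" where "cells = {1..n} \<times> {1..n}"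

section \<open>Spacing of one player's points and the answers to cuts\<close>

lemma WS_instancesD:
  assumes "x \<in> WS_instances n \<epsilon>" "p \<in> {1..n}" "i \<in> {1..n}"
  shows "\<exists>k\<in>{1..n}. x p i = kth_point n \<epsilon> i k"
proof -
  have "x p i \<in> (\<lambda>p. x p i) ` {1..n}" using assms(2) by blast
  also have "\<dots> = X n \<epsilon> i" using assms(1,3) by (simp add: WS_instances_def bij_betw_def)
  finally show ?thesis by (auto simp: X_def)
qed

lemma WS_instances_inj:
  assumes "x \<in> WS_instances n \<epsilon>" "i \<in> {1..n}"
  shows "inj_on (\<lambda>p. x p i) {1..n}"
  using assms by (auto simp: WS_instances_def bij_betw_def)

lemma centre_bounds:
  assumes "x \<in> WS_instances n \<epsilon>" "p \<in> {1..n}" "j \<le> n"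
  shows "real j / (real n + 1) \<le> centre x p j" "centre x p j < (real j + 1) / (real n + 1)"
    "j > 0 \<Longrightarrow> real j / (real n + 1) + \<epsilon> \<le> centre x p j"
proof -
  have *: "j = 0 \<and> centre x p j = 0 \<or>
           (\<exists>k. real j / (real n + 1) + \<epsilon> \<le> centre x p j \<and> centre x p j \<le> real j / (real n + 1) + real n * \<epsilon>)"
  proof (cases "j = 0")
    case False
    then obtain k where k: "k \<in> {1..n}" "x p j = kth_point n \<epsilon> j k"
      using WS_instancesD[OF assms(1,2), of j] assms by auto
    have "1 * \<epsilon> \<le> real k * \<epsilon>" "real k * \<epsilon> \<le> real n * \<epsilon>"
      using k eps0 by (auto intro!: mult_right_mono)
    with k False show ?thesis by (simp add: centre_def kth_point_def)
  qed (simp add: centre_def)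
  have "real n * \<epsilon> > 0" using n2 eps0 by simp
  with * n_eps eps0 show "real j / (real n + 1) \<le> centre x p j"
    "centre x p j < (real j + 1) / (real n + 1)"
    "j > 0 \<Longrightarrow> real j / (real n + 1) + \<epsilon> \<le> centre x p j"
    unfolding add_divide_distrib by auto
qed

lemma centre_step:
  assumes "x \<in> WS_instances n \<epsilon>" "p \<in> {1..n}" "j < n"
  shows "centre x p j + \<epsilon> \<le> centre x p (Suc j)"
proof -
  have "real (Suc j) / (real n + 1) + \<epsilon> \<le> centre x p (Suc j)"
    using centre_bounds(3)[of x p "Suc j"] assms by auto
  moreover have "centre x p j < real (Suc j) / (real n + 1)"
    using centre_bounds(2)[of x p j] assms by (auto simp: add.commute)
  ultimately show ?thesis by linarith
qed

text \<open>A distance of \<epsilon> is twice the half-width of a block, so distinct blocks of one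
  player at most touch.\<close>

lemma centre_mono:
  assumes "x \<in> WS_instances n \<epsilon>" "p \<in> {1..n}" "i < j" "j \<le> n"
  shows "centre x p i + \<epsilon> \<le> centre x p j"
  using assms(3,4)
proof (induction j)
  case (Suc j)
  then show ?case
    using centre_step[OF assms(1,2), of j] eps0 by (cases "i = j") auto
qed simp

text \<open>Up to \<open>x p i\<close> lie the i full blocks 0, ..., i-1 and the left half of block
  i, and i/(n+1) + i/(n^2+n) = i/n. Stopping earlier loses part of that left half, which has
  positive density.\<close>

lemma measure_WS_upto_centre:
  assumes x: "x \<in> WS_instances n \<epsilon>" and p: "p \<in> {1..n}" and i: "i \<in> {1..n}"
  shows "measure (WS_measure n \<epsilon> x p) {0..x p i} = real i / real n"
    and "0 \<le> z \<Longrightarrow> z < x p i \<Longrightarrow> measure (WS_measure n \<epsilon> x p) {0..z} < real i / real n"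
proof -
  have ci: "centre x p i = x p i" using i by (simp add: centre_def)
  have up: "block_mass (centre x p j) j {0..z} = 0" if "z \<le> x p i" "j \<in> {i<..n}" for j z
    using centre_mono[OF x p, of i j] that eps0 ci by (intro block_mass_eq_0) auto
  have split: "measure (WS_measure n \<epsilon> x p) {0..z} =
      (\<Sum>j<i. block_mass (centre x p j) j {0..z}) + block_mass (x p i) i {0..z}" if "z \<le> x p i" for z
  proof -
    have "measure (WS_measure n \<epsilon> x p) {0..z} = (\<Sum>j\<in>{0..n}. block_mass (centre x p j) j {0..z})"
      by (simp add: measure_WS)
    also have "\<dots> = (\<Sum>j\<in>{..i}. block_mass (centre x p j) j {0..z})"
      using i that by (intro sum.mono_neutral_right) (auto intro!: up)
    also have "{..i} = insert i {..<i}" by auto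
    finally show ?thesis by (simp add: ci)
  qed
  have den: "real i / (real n + 1) + real i / (real n ^ 2 + real n) = real i / real n"
  proof -
    have "real n ^ 2 + real n = real n * (real n + 1)" by (simp add: power2_eq_square algebra_simps)
    moreover have "real n + 1 \<noteq> 0" "real n \<noteq> 0" using n2 by auto
    ultimately show ?thesis by (simp add: divide_simps) (simp add: algebra_simps)
  qed
  have half: "x p i - \<epsilon> / 2 \<ge> 0"
  proof -
    have "real i / (real n + 1) \<ge> 0" by simp
    moreover have "real i / (real n + 1) + \<epsilon> \<le> x p i"
      using centre_bounds(3)[OF x p, of i] i ci by auto
    ultimately show ?thesis using eps0 by linarith
  qed
  show "measure (WS_measure n \<epsilon> x p) {0..x p i} = real i / real n"
  proof -
    have "block_mass (centre x p j) j {0..x p i} = 1 / (real n + 1)" if "j < i" for j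
    proof (rule block_mass_full)
      have "centre x p j + \<epsilon> \<le> x p i" using centre_mono[OF x p that] i ci by simp
      moreover have "j = 0 \<and> centre x p j = 0 \<or> centre x p j - \<epsilon> / 2 \<ge> 0"
      proof (cases "j = 0")
        case False
        have "real j / (real n + 1) \<ge> 0" by simp
        moreover have "real j / (real n + 1) + \<epsilon> \<le> centre x p j"
          using centre_bounds(3)[OF x p, of j] that i False by auto
        ultimately show ?thesis using eps0 by linarith
      qed (simp add: centre_def)
      ultimately show "{centre x p j - \<epsilon> / 2..centre x p j + \<epsilon> / 2} \<subseteq> {0..x p i} \<or>
          j = 0 \<and> {centre x p j..centre x p j + \<epsilon> / 2} \<subseteq> {0..x p i}"
        using eps0 by auto
    qed
    moreover have "block_mass (x p i) i {0..x p i} = real i / (real n ^ 2 + real n)"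
    proof -
      have "{x p i - \<epsilon> / 2..x p i} \<inter> {0..x p i} = {x p i - \<epsilon> / 2..x p i}"
        "{x p i..x p i + \<epsilon> / 2} \<inter> {0..x p i} \<subseteq> {x p i}" using half by auto
      with measure_subset_singleton[OF this(2)] eps0 show ?thesis
        by (simp add: block_mass_def)
    qed
    ultimately show ?thesis using den by (simp add: split)
  qed
  assume z: "0 \<le> z" "z < x p i"
  have "(\<Sum>j<i. block_mass (centre x p j) j {0..z}) \<le> (\<Sum>j<i. 1 / (real n + 1))"
    using i by (intro sum_mono block_mass_bounds) auto
  moreover have "block_mass (x p i) i {0..z} < real i / (real n ^ 2 + real n)"
  proof -
    have "measure lborel ({x p i - \<epsilon> / 2..x p i} \<inter> {0..z}) \<le> measure lborel {x p i - \<epsilon> / 2..z}"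
      by (intro measure_mono_fmeasurable) (auto simp: fmeasurable_def emeasure_lborel_Icc_eq)
    also have "\<dots> < \<epsilon> / 2"
      using z eps0 by (cases "x p i - \<epsilon> / 2 \<le> z") auto
    finally have "measure lborel ({x p i - \<epsilon> / 2..x p i} \<inter> {0..z}) / (\<epsilon> / 2) < 1"
      using eps0 by simp
    then have "real i / (real n ^ 2 + real n) * (measure lborel ({x p i - \<epsilon> / 2..x p i} \<inter> {0..z}) / (\<epsilon> / 2))
        < real i / (real n ^ 2 + real n) * 1"
      using i by (intro mult_strict_left_mono) (auto intro!: divide_pos_pos add_pos_pos)
    moreover have "{x p i..x p i + \<epsilon> / 2} \<inter> {0..z} = {}" using z by auto
    ultimately show ?thesis by (simp add: block_mass_def)
  qed
  ultimately show "measure (WS_measure n \<epsilon> x p) {0..z} < real i / real n"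
    using den split[of z] z by simp
qed

lemma answer_WS:
  assumes x: "x \<in> WS_instances n \<epsilon>" and p: "p \<in> {1..n}" and i: "i \<in> {1..n}"
  shows "answer (WS_measure n \<epsilon> x) (Cut p (real i / real n)) = x p i"
proof -
  have ci: "centre x p i = x p i" using i by (simp add: centre_def)
  have "0 \<le> real i / (real n + 1)" by simp
  also have "\<dots> \<le> x p i" using centre_bounds(1)[OF x p, of i] i ci by simp
  finally have 0: "0 \<le> x p i" .
  have "x p i < (real i + 1) / (real n + 1)" using centre_bounds(2)[OF x p, of i] i ci by simp
  also have "\<dots> \<le> 1" using i by simp
  finally have 1: "x p i < 1" .
  have "quantile_point (WS_measure n \<epsilon> x p) (real i / real n) = x p i"
    unfolding quantile_point_def
  \<comment> \<open>Strictness below \<open>x p i\<close> makes the infimum of the level set an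
    attained minimum.\<close>
  proof (rule cInf_eq_minimum)
    show "x p i \<in> {z \<in> {0..1}. measure (WS_measure n \<epsilon> x p) {0..z} = real i / real n}"
      using 0 1 measure_WS_upto_centre(1)[OF x p i] by simp
    show "x p i \<le> z" if "z \<in> {z \<in> {0..1}. measure (WS_measure n \<epsilon> x p) {0..z} = real i / real n}" for z
      using that measure_WS_upto_centre(2)[OF x p i, of z] by force
  qed
  then show ?thesis by simp
qed

text \<open>Mass 1/n exceeds what one block can give, so two blocks are met; by monotonicity the
  later one may be replaced by the successor of the earlier one. The slack \<epsilon>/2 allows for
  interval ends inside a block.\<close>

lemma heavy_interval:
  assumes x: "x \<in> WS_instances n \<epsilon>" and p: "p \<in> {1..n}"
    and heavy: "measure (WS_measure n \<epsilon> x p) {a..<b} \<ge> 1 / real n"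
  shows "\<exists>j<n. a < centre x p j + \<epsilon> / 2 \<and> centre x p (Suc j) - \<epsilon> / 2 < b"
proof -
  define m where "m = (\<lambda>j. block_mass (centre x p j) j {a..<b})"
  define Z where "Z = {j\<in>{0..n}. m j \<noteq> 0}"
  have Zint: "{a..<b} \<inter> {centre x p j - \<epsilon> / 2<..<centre x p j + \<epsilon> / 2} \<noteq> {}" if "j \<in> Z" for j
    using that block_mass_eq_0[of "{a..<b}"] by (auto simp: Z_def m_def)
  have "1 / real n \<le> sum m {0..n}" using heavy by (simp add: m_def measure_WS)
  also have "\<dots> = sum m Z" by (intro sum.mono_neutral_right) (auto simp: Z_def)
  also have "\<dots> \<le> (\<Sum>j\<in>Z. 1 / (real n + 1))"
    by (intro sum_mono) (auto simp: m_def Z_def intro!: block_mass_bounds)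
  finally have "1 / real n \<le> real (card Z) / (real n + 1)" by simp
  then have "real n + 1 \<le> real (card Z) * real n" using n2 by (simp add: field_simps)
  then have "card Z > 1" using n2 by (cases "card Z \<le> 1") (auto simp: le_Suc_eq)
  moreover have "finite Z" by (simp add: Z_def)
  ultimately obtain i j where ij: "i \<in> Z" "j \<in> Z" "i < j"
    by (metis One_nat_def card_le_Suc0_iff_eq linorder_neqE_nat not_le)
  have jn: "j \<le> n" using ij by (simp add: Z_def)
  have "a < centre x p i + \<epsilon> / 2" "centre x p j - \<epsilon> / 2 < b"
    using Zint[OF ij(1)] Zint[OF ij(2)] by auto
  moreover have "centre x p (Suc i) \<le> centre x p j"
    using centre_mono[OF x p, of "Suc i" j] ij jn eps0 by (cases "Suc i = j") auto
  ultimately show ?thesis using ij jn by (intro exI[of _ i]) auto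
qed

section \<open>Fair allocations determine the permutation\<close>

lemma kth_point_gap:
  assumes "i \<le> Suc n" "j \<le> Suc n" "k \<le> n" "l \<le> n" "kth_point n \<epsilon> i k < kth_point n \<epsilon> j l"
  shows "kth_point n \<epsilon> i k + \<epsilon> \<le> kth_point n \<epsilon> j l"
proof -
  have far: "kth_point n \<epsilon> i k + \<epsilon> \<le> kth_point n \<epsilon> j l" if "i < j" "k \<le> n" for i j k l
  proof -
    have "(real i + 1) / (real n + 1) \<le> real j / (real n + 1)"
      using that by (intro divide_right_mono) auto
    moreover have "(real k + 1) * \<epsilon> \<le> (real n + 1) * \<epsilon>" "0 \<le> real l * \<epsilon>"
      using that eps0 by (auto intro!: mult_right_mono)
    ultimately show ?thesis
      using n_eps1 unfolding kth_point_def add_divide_distrib distrib_right by linarith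
  qed
  consider "i < j" | "j < i" | "i = j" by linarith
  then show ?thesis
  proof cases
    case 1 then show ?thesis using far assms by blast
  next
    case 2 then show ?thesis using far[of j i l k] assms eps0 by linarith
  next
    case 3
    then have "k < l" using assms kth_point_less_iff by simp
    then have "(real k + 1) * \<epsilon> \<le> real l * \<epsilon>" using eps0 by (intro mult_right_mono) auto
    with 3 show ?thesis by (simp add: kth_point_def distrib_right)
  qed
qed

definition grid :: "real set" where
  "grid = {kth_point n \<epsilon> i k | i k. i \<le> Suc n \<and> k \<le> n}"

text \<open>This removes the slack of \<open>heavy_interval\<close>: for grid points, u < v +
  \<epsilon>/2 already gives u \<le> v.\<close>

lemma grid_gap: "u \<in> grid \<Longrightarrow> v \<in> grid \<Longrightarrow> u < v \<Longrightarrow> u + \<epsilon> \<le> v"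
  using kth_point_gap by (auto simp: grid_def)

lemma zero_one_in_grid: "0 \<in> grid" "1 \<in> grid"
proof -
  have "0 = kth_point n \<epsilon> 0 0" "1 = kth_point n \<epsilon> (Suc n) 0" by (auto simp: kth_point_def)
  then show "0 \<in> grid" "1 \<in> grid" unfolding grid_def by blast+
qed

lemma WS_in_grid:
  assumes "x \<in> WS_instances n \<epsilon>" "p \<in> {1..n}" "i \<in> {1..n}"
  shows "x p i \<in> grid"
proof -
  obtain k where "k \<in> {1..n}" "x p i = kth_point n \<epsilon> i k" using WS_instancesD[OF assms] by blast
  moreover have "i \<le> Suc n" "k \<le> n" using \<open>k \<in> {1..n}\<close> assms(3) by auto
  ultimately show ?thesis unfolding grid_def by blast
qed

text \<open>The definition gives three implications; they become equivalences because on either side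
  exactly one alternative holds.\<close>

lemma J_permD:
  assumes "x \<in> J_perm n \<epsilon> \<pi>" "p \<in> {1..n}" "i \<in> {1..n}"
  shows "\<pi> p = i \<longleftrightarrow> x p i = kth_point n \<epsilon> i i"
    "\<pi> p < i \<longleftrightarrow> x p i < kth_point n \<epsilon> i i"
    "\<pi> p > i \<longleftrightarrow> x p i > kth_point n \<epsilon> i i"
proof -
  have 1: "\<pi> p = i \<Longrightarrow> x p i = kth_point n \<epsilon> i i"
    using assms by (auto simp: J_perm_def)
  have 2: "x p i < kth_point n \<epsilon> i i" if "\<pi> p < i"
  proof -
    from that assms have "x p i \<in> kth_point n \<epsilon> i ` {1..i - 1}" unfolding J_perm_def by blast
    then obtain k where "k \<in> {1..i - 1}" "x p i = kth_point n \<epsilon> i k" by blast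
    moreover have "k < i" using \<open>k \<in> {1..i - 1}\<close> that by auto
    ultimately show ?thesis by (simp add: kth_point_less_iff)
  qed
  have 3: "x p i > kth_point n \<epsilon> i i" if "\<pi> p > i"
  proof -
    from that assms have "x p i \<in> kth_point n \<epsilon> i ` {i + 1..n}" unfolding J_perm_def by blast
    then obtain k where "k \<in> {i + 1..n}" "x p i = kth_point n \<epsilon> i k" by blast
    moreover have "k > i" using \<open>k \<in> {i + 1..n}\<close> that by auto
    ultimately show ?thesis by (simp add: kth_point_less_iff)
  qed
  show "\<pi> p = i \<longleftrightarrow> x p i = kth_point n \<epsilon> i i"
    "\<pi> p < i \<longleftrightarrow> x p i < kth_point n \<epsilon> i i"
    "\<pi> p > i \<longleftrightarrow> x p i > kth_point n \<epsilon> i i"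
    using 1 2 3 by (cases "\<pi> p" i rule: linorder_cases; force)+
qed

lemma J_perm_WS: "x \<in> J_perm n \<epsilon> \<pi> \<Longrightarrow> x \<in> WS_instances n \<epsilon>"
  by (simp add: J_perm_def)

lemma J_WS: "x \<in> J n \<epsilon> \<Longrightarrow> x \<in> WS_instances n \<epsilon>"
  by (auto simp: J_def J_perm_def)

text \<open>In a fair allocation each player gets one of the slots between consecutive groups \<open>X\<^sub>i\<close>.
  The owners of slots \<open>i\<close> and \<open>i + 1\<close> appear in this order in \<open>X\<^sub>i\<close>, which inductively
  forces \<open>\<pi> p \<ge> s p\<close> for the slot \<open>s p\<close> of \<open>p\<close>, hence equality.\<close>

lemma fair_allocation_slots:
  assumes x: "x \<in> J_perm n \<epsilon> \<pi>" and \<pi>: "\<pi> permutes {1..n}"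
    and ends: "\<And>p. p \<in> {1..n} \<Longrightarrow> fst (A p) \<in> grid \<and> snd (A p) \<in> grid"
    and disj: "disjoint_family_on (interval_of A) {1..n}"
    and fair: "\<And>p. p \<in> {1..n} \<Longrightarrow> measure (WS_measure n \<epsilon> x p) (interval_of A p) \<ge> 1 / real n"
    and p: "p \<in> {1..n}"
  shows "real (\<pi> p) / (real n + 1) \<in> interval_of A p"
proof -
  note W = J_perm_WS[OF x]
  \<comment> \<open>Slot s runs from the player's point in group s-1 to that in group s; slot 1
    starts at the artificial centre 0.\<close>
  have "\<exists>s\<in>{1..n}. fst (A p) \<le> centre x p (s - 1) \<and> x p s \<le> snd (A p)" if p: "p \<in> {1..n}" for p
  proof -
    from heavy_interval[OF W p fair[OF p, unfolded interval_of_def]]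
    obtain j where j: "j < n" "fst (A p) < centre x p j + \<epsilon> / 2"
      "centre x p (Suc j) - \<epsilon> / 2 < snd (A p)" by blast
    have "centre x p j \<in> grid" "centre x p (Suc j) \<in> grid"
      using WS_in_grid[OF W p] j(1) zero_one_in_grid by (auto simp: centre_def)
    with j ends[OF p] have "fst (A p) \<le> centre x p j" "centre x p (Suc j) \<le> snd (A p)"
      using grid_gap[of "centre x p j" "fst (A p)"] grid_gap[of "snd (A p)" "centre x p (Suc j)"] eps0
      by (auto simp: not_le[symmetric])
    with j(1) show ?thesis by (intro bexI[of _ "Suc j"]) (auto simp: centre_def)
  qed
  then obtain s where s: "\<And>p. p \<in> {1..n} \<Longrightarrow> s p \<in> {1..n}"
    "\<And>p. p \<in> {1..n} \<Longrightarrow> fst (A p) \<le> centre x p (s p - 1)"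
    "\<And>p. p \<in> {1..n} \<Longrightarrow> x p (s p) \<le> snd (A p)"
    by metis
  \<comment> \<open>The base of group s separates groups s-1 and s for all players at once. Two
    owners of one slot would therefore share this point, which makes \<open>s\<close>
    injective.\<close>
  have slot: "fst (A p) < real (s p) / (real n + 1) \<and> real (s p) / (real n + 1) < snd (A p)"
    if p: "p \<in> {1..n}" for p
  proof -
    have "centre x p (s p - 1) < real (s p) / (real n + 1)"
      using centre_bounds(2)[OF W p, of "s p - 1"] s(1)[OF p] by (auto simp: of_nat_diff)
    moreover have "real (s p) / (real n + 1) + \<epsilon> \<le> x p (s p)"
      using centre_bounds(3)[OF W p, of "s p"] s(1)[OF p] by (auto simp: centre_def)
    ultimately show ?thesis using s(2,3)[OF p] eps0 by linarith
  qed
  then have slot_in: "real (s p) / (real n + 1) \<in> interval_of A p" if "p \<in> {1..n}" for p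
    using that by (auto simp: interval_of_def intro: less_imp_le)
  have inj: "inj_on s {1..n}"
  proof (rule inj_onI, rule ccontr)
    fix p q assume pq: "p \<in> {1..n}" "q \<in> {1..n}" "s p = s q" "p \<noteq> q"
    then have "interval_of A p \<inter> interval_of A q = {}"
      using disj unfolding disjoint_family_on_def by blast
    with slot_in[OF pq(1)] slot_in[OF pq(2)] pq(3) show False by auto
  qed
  have surj: "s ` {1..n} = {1..n}"
    using inj s(1) by (intro endo_inj_surj) auto
  have chain: "x p (s p) \<le> x q (s p)"
    if p: "p \<in> {1..n}" and q: "q \<in> {1..n}" and pq: "s q = Suc (s p)" for p q
  proof -
    have "snd (A p) \<le> fst (A q)"
    proof (rule ccontr)
      assume *: "\<not> snd (A p) \<le> fst (A q)"
      have "real (s p) / (real n + 1) < real (s q) / (real n + 1)"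
        using pq by (intro divide_strict_right_mono) auto
      \<comment> \<open>If the interval of p reached beyond the start of that of q, this point would
        be in both: the base of p's slot precedes that of q's.\<close>
      then have "max (fst (A q)) (real (s p) / (real n + 1)) \<in> interval_of A p \<inter> interval_of A q"
        using * slot[OF p] slot[OF q] by (auto simp: interval_of_def max_def)
      moreover have "p \<noteq> q" using pq by auto
      ultimately show False using disj p q unfolding disjoint_family_on_def by blast
    qed
    with s(3)[OF p] s(2)[OF q] s(1)[OF p] pq show ?thesis by (simp add: centre_def)
  qed
  have ge: "s p \<le> \<pi> p" if "p \<in> {1..n}" "s p = i" for p i
    using that
  proof (induction i arbitrary: p)
    case 0 then show ?case using s(1)[of p] by auto
  next
    case (Suc i q)
    show ?case
    proof (cases "i = 0")
      case True
      then show ?thesis using Suc.prems \<pi> permutes_in_image[OF \<pi>, of q] by auto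
    next
      case False
      then have i: "i \<in> {1..n}" using s(1)[of q] Suc.prems by auto
      then have "i \<in> s ` {1..n}" using surj by simp
      then obtain p where p: "p \<in> {1..n}" "s p = i" by blast
      with Suc.IH have "i \<le> \<pi> p" by blast
      then have "kth_point n \<epsilon> i i \<le> x p i"
        using J_permD[OF x p(1) i] by (auto simp: le_less)
      also have "\<dots> \<le> x q i" using chain[of p q] p Suc.prems by simp
      finally have le: "kth_point n \<epsilon> i i \<le> x q i" .
      \<comment> \<open>Distinct players have distinct points in X_i, so the weak order becomes
        strict and the induction gains one.\<close>
      moreover have "x q i \<noteq> kth_point n \<epsilon> i i"
      proof
        assume eq: "x q i = kth_point n \<epsilon> i i"
        with \<open>x p i \<le> x q i\<close> \<open>kth_point n \<epsilon> i i \<le> x p i\<close> have "x p i = x q i" by simp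
        then have "p = q"
          using inj_onD[OF WS_instances_inj[OF W i] _ p(1) Suc.prems(1)] by simp
        then show False using p Suc.prems by simp
      qed
      ultimately show ?thesis using J_permD(3)[OF x Suc.prems(1) i] Suc.prems by simp
    qed
  qed
  \<comment> \<open>Both maps are bijections of {1..n}; with equal sums, a pointwise inequality is
    an equality.\<close>
  have "sum s {1..n} = sum \<pi> {1..n}"
  proof -
    have "sum s {1..n} = \<Sum>{1..n}" using sum.reindex[OF inj, of id] surj by simp
    also have "\<dots> = sum \<pi> {1..n}"
      using sum.permute[OF \<pi>, of id] by simp
    finally show ?thesis .
  qed
  then have "s p = \<pi> p"
    using sum_mono_inv[of s "{1..n}" \<pi> p] ge p by auto
  with slot_in[OF p] show ?thesis by simp
qed

text \<open>If \<rho> q = \<pi> p, then the base of this slot lies in the interval of p by the first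
  instance and in that of q by the second; disjointness gives p = q.\<close>

lemma fair_allocation_unique_permutation:
  assumes x: "x \<in> J_perm n \<epsilon> \<pi>" and \<pi>: "\<pi> permutes {1..n}"
    and y: "y \<in> J_perm n \<epsilon> \<rho>" and \<rho>: "\<rho> permutes {1..n}"
    and ends: "\<And>p. p \<in> {1..n} \<Longrightarrow> fst (A p) \<in> grid \<and> snd (A p) \<in> grid"
    and disj: "disjoint_family_on (interval_of A) {1..n}"
    and fair_x: "\<And>p. p \<in> {1..n} \<Longrightarrow> measure (WS_measure n \<epsilon> x p) (interval_of A p) \<ge> 1 / real n"
    and fair_y: "\<And>p. p \<in> {1..n} \<Longrightarrow> measure (WS_measure n \<epsilon> y p) (interval_of A p) \<ge> 1 / real n"
  shows "\<pi> = \<rho>"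
proof
  fix p
  show "\<pi> p = \<rho> p"
  proof (cases "p \<in> {1..n}")
    case True
    then have "\<pi> p \<in> \<rho> ` {1..n}"
      using permutes_in_image[OF \<pi>] permutes_image[OF \<rho>] by simp
    then obtain q where q: "q \<in> {1..n}" "\<rho> q = \<pi> p" by (metis imageE)
    have "real (\<pi> p) / (real n + 1) \<in> interval_of A p \<inter> interval_of A q"
      using fair_allocation_slots[OF x \<pi> ends disj fair_x True]
        fair_allocation_slots[OF y \<rho> ends disj fair_y q(1)] q(2) by simp
    then have "\<not> interval_of A p \<inter> interval_of A q = {}" by blast
    with disj True q(1) have "p = q" unfolding disjoint_family_on_def by blast
    with q(2) show ?thesis by simp
  qed (use \<pi> \<rho> in \<open>simp add: permutes_def\<close>)
qed

end

section \<open>Counting instances with revealed cells\<close>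

text \<open>With m positions left in \<open>F\<close>, at most m values are possible, and m * (m-1)!
  = m!. For m = 0 truncated subtraction breaks that identity, but then \<open>V\<close> is
  empty.\<close>

lemma card_mult_fact_le:
  fixes V :: "'b set" and g :: "'a \<Rightarrow> 'b"
  assumes "finite F" "inj_on g L" "g ` L \<subseteq> F" "V \<subseteq> F - g ` L"
  shows "real (card V) * fact (card F - card L - 1) \<le> fact (card F - card L)"
proof -
  have "card V \<le> card (F - g ` L)" using assms by (intro card_mono) auto
  also have "\<dots> = card F - card (g ` L)"
    using assms by (intro card_Diff_subset) (auto intro: finite_subset)
  also have "card (g ` L) = card L" using assms by (intro card_image) auto
  finally have V: "card V \<le> card F - card L" .
  show ?thesis
  proof (cases "card F - card L = 0")
    case False
    have "real (card V) * fact (card F - card L - 1) \<le> real (card F - card L) * fact (card F - card L - 1)"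
      using V by (intro mult_right_mono) auto
    also have "\<dots> = fact (card F - card L)"
      using False by (subst (2) fact_reduce) auto
    finally show ?thesis .
  qed (use V in simp)
qed

text \<open>Here \<open>x\<close> is a carrier for the values revealed on \<open>S\<close> and need
  not be an instance; at the root it is the zero function.\<close>

definition agree :: "(nat \<Rightarrow> nat \<Rightarrow> real) \<Rightarrow> (nat \<times> nat) set \<Rightarrow> (nat \<Rightarrow> nat \<Rightarrow> real) \<Rightarrow> bool" where
  "agree x S y \<longleftrightarrow> (\<forall>(p, i)\<in>S. y p i = x p i)"

definition upd :: "(nat \<Rightarrow> nat \<Rightarrow> real) \<Rightarrow> nat \<Rightarrow> nat \<Rightarrow> real \<Rightarrow> nat \<Rightarrow> nat \<Rightarrow> real" where
  "upd x p i v = x(p := (x p)(i := v))"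

lemma upd_apply: "upd x p i v q j = (if q = p \<and> j = i then v else x q j)"
  by (simp add: upd_def)

lemma agreeD: "agree x S y \<Longrightarrow> (p, i) \<in> S \<Longrightarrow> y p i = x p i"
  by (auto simp: agree_def)

lemma agree_upd: "agree x S y \<Longrightarrow> y p i = v \<Longrightarrow> agree (upd x p i v) (insert (p, i) S) y"
  by (auto simp: agree_def upd_apply)

context ws_parameters
begin

definition low :: "(nat \<Rightarrow> nat \<Rightarrow> real) \<Rightarrow> (nat \<times> nat) set \<Rightarrow> nat \<Rightarrow> nat set" where
  "low x S i = {p. (p, i) \<in> S \<and> x p i < kth_point n \<epsilon> i i}"

definition high :: "(nat \<Rightarrow> nat \<Rightarrow> real) \<Rightarrow> (nat \<times> nat) set \<Rightarrow> nat \<Rightarrow> nat set" where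
  "high x S i = {p. (p, i) \<in> S \<and> x p i > kth_point n \<epsilon> i i}"

text \<open>For each permutation \<open>\<pi>\<close> compatible with the values of \<open>x\<close> on the revealed cells \<open>S\<close>, this is
  the number of instances in \<open>J\<^sub>\<pi>\<close> agreeing with \<open>x\<close> on \<open>S\<close>; it does not depend on \<open>\<pi>\<close>.\<close>

definition weight :: "(nat \<Rightarrow> nat \<Rightarrow> real) \<Rightarrow> (nat \<times> nat) set \<Rightarrow> real" where
  "weight x S = (\<Prod>i\<in>{1..n}. fact (i - 1 - card (low x S i)) * fact (n - i - card (high x S i)))"

text \<open>Truncated subtraction keeps this true for incompatible data; it settles empty classes
  and repeated queries.\<close>

lemma weight_ge_1: "1 \<le> weight x S"
  unfolding weight_def by (intro prod_ge_1) (simp add: fact_ge_1 mult_ge1_I)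

lemma low_upd: "(p, i) \<notin> S \<Longrightarrow> low (upd x p i v) (insert (p, i) S) j =
    (if j = i \<and> v < kth_point n \<epsilon> i i then insert p (low x S i) else low x S j)"
  by (auto simp: low_def upd_apply)

lemma high_upd: "(p, i) \<notin> S \<Longrightarrow> high (upd x p i v) (insert (p, i) S) j =
    (if j = i \<and> v > kth_point n \<epsilon> i i then insert p (high x S i) else high x S j)"
  by (auto simp: high_def upd_apply)

lemma WS_low:
  assumes "y \<in> WS_instances n \<epsilon>" "p \<in> {1..n}" "i \<in> {1..n}" "y p i < kth_point n \<epsilon> i i"
  shows "y p i \<in> kth_point n \<epsilon> i ` {1..<i}"
  using WS_instancesD[OF assms(1-3)] assms(4) by (auto simp: kth_point_less_iff)

lemma WS_high:
  assumes "y \<in> WS_instances n \<epsilon>" "p \<in> {1..n}" "i \<in> {1..n}" "y p i > kth_point n \<epsilon> i i"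
  shows "y p i \<in> kth_point n \<epsilon> i ` {i<..n}"
  using WS_instancesD[OF assms(1-3)] assms(4) by (auto simp: kth_point_less_iff)

lemma weight_split:
  assumes "i \<in> {1..n}"
  shows "weight x S = fact (i - 1 - card (low x S i)) * fact (n - i - card (high x S i)) *
    (\<Prod>j\<in>{1..n} - {i}. fact (j - 1 - card (low x S j)) * fact (n - j - card (high x S j)))"
  unfolding weight_def using assms by (subst prod.remove[of _ i]) auto

section \<open>Change of the weight when one cell is revealed\<close>

context
  fixes x :: "nat \<Rightarrow> nat \<Rightarrow> real" and S :: "(nat \<times> nat) set" and C p i and V :: "real set"
  assumes C: "C \<subseteq> WS_instances n \<epsilon>" "\<And>y. y \<in> C \<Longrightarrow> agree x S y"
    and S: "S \<subseteq> cells" and pi: "(p, i) \<in> cells" "(p, i) \<notin> S"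
    and V: "V \<subseteq> (\<lambda>y. y p i) ` C"
begin

text \<open>Points in one group are distinct, and \<open>y\<close> carries the revealed values, so
  its value at the new cell cannot repeat one of them.\<close>

lemma unrevealed_value:
  assumes "y \<in> C" "L \<subseteq> {q. (q, i) \<in> S}"
  shows "inj_on (\<lambda>q. x q i) L" "y p i \<notin> (\<lambda>q. x q i) ` L" "p \<notin> L" "finite L"
proof -
  have y: "x q i = y q i" "q \<in> {1..n}" if "q \<in> L" for q
    using that assms agreeD[OF C(2)[of y], of q i] S by (auto simp: cells_def)
  have i: "i \<in> {1..n}" and p: "p \<in> {1..n}" using pi by (auto simp: cells_def)
  have inj: "inj_on (\<lambda>q. y q i) {1..n}" using WS_instances_inj[OF _ i] C(1) assms(1) by blast
  show pL: "p \<notin> L" using pi(2) assms(2) by auto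
  show "inj_on (\<lambda>q. x q i) L"
  proof (rule inj_onI)
    fix q r assume qr: "q \<in> L" "r \<in> L" "x q i = x r i"
    then have "y q i = y r i" using y(1)[of q] y(1)[of r] by metis
    then show "q = r" by (rule inj_onD[OF inj _ y(2)[OF qr(1)] y(2)[OF qr(2)]])
  qed
  show "y p i \<notin> (\<lambda>q. x q i) ` L"
  proof
    assume "y p i \<in> (\<lambda>q. x q i) ` L"
    then obtain q where "q \<in> L" "y p i = x q i" by blast
    then have "y p i = y q i" using y(1)[of q] by metis
    then have "p = q" by (rule inj_onD[OF inj _ p y(2)[OF \<open>q \<in> L\<close>]])
    with \<open>q \<in> L\<close> pL show False by simp
  qed
  show "finite L" using y(2) by (intro finite_subset[of L "{1..n}"]) auto
qed

text \<open>Such a value turns one factor m! into (m-1)!, where m counts the lower positions not yet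
  revealed, and at most m values are available. All other factors stay the same.\<close>

lemma weight_step_low:
  assumes "\<And>v. v \<in> V \<Longrightarrow> v < kth_point n \<epsilon> i i"
  shows "(\<Sum>v\<in>V. weight (upd x p i v) (insert (p, i) S)) \<le> weight x S"
proof (cases "V = {}")
  case True
  then show ?thesis using weight_ge_1[of x S] by simp
next
  case False
  then obtain y0 where y0: "y0 \<in> C" using V by auto
  have pn: "p \<in> {1..n}" and i: "i \<in> {1..n}" using pi by (auto simp: cells_def)
  define L where "L = low x S i"
  have LS: "L \<subseteq> {q. (q, i) \<in> S}" by (auto simp: L_def low_def)
  note u = unrevealed_value[OF y0 LS]
  define F where "F = kth_point n \<epsilon> i ` {1..<i}"
  have cF: "card F = i - 1"
    unfolding F_def by (subst card_image) (auto intro: inj_on_subset[OF inj_kth_point])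
  define R where "R = fact (n - i - card (high x S i)) *
    (\<Prod>j\<in>{1..n} - {i}. fact (j - 1 - card (low x S j)) * fact (n - j - card (high x S j)) :: real)"
  have R: "R \<ge> 0" unfolding R_def by (intro mult_nonneg_nonneg prod_nonneg) auto
  have w: "weight x S = fact (i - 1 - card L) * R"
    using weight_split[OF i] by (simp add: R_def L_def mult.assoc)
  have "weight (upd x p i v) (insert (p, i) S) = fact (i - 1 - card L - 1) * R" if "v \<in> V" for v
    using assms[OF that] u(3,4) pi(2)
    by (subst weight_split[OF i]) (simp add: R_def L_def mult.assoc low_upd high_upd)
  then have "(\<Sum>v\<in>V. weight (upd x p i v) (insert (p, i) S)) = (real (card V) * fact (i - 1 - card L - 1)) * R"
    by simp
  also have "real (card V) * fact (i - 1 - card L - 1) \<le> fact (i - 1 - card L)"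
    unfolding cF[symmetric]
  proof (rule card_mult_fact_le)
    show "finite F" by (simp add: F_def)
    show "inj_on (\<lambda>q. x q i) L" by (rule u)
    show "(\<lambda>q. x q i) ` L \<subseteq> F"
    proof
      fix v assume "v \<in> (\<lambda>q. x q i) ` L"
      then obtain q where q: "(q, i) \<in> S" "x q i < kth_point n \<epsilon> i i" "v = x q i"
        by (auto simp: L_def low_def)
      then have "x q i = y0 q i" "q \<in> {1..n}" using agreeD[OF C(2)[OF y0]] S by (auto simp: cells_def)
      with q WS_low[of y0 q i] C(1) y0 i show "v \<in> F" by (auto simp: F_def)
    qed
    show "V \<subseteq> F - (\<lambda>q. x q i) ` L"
    proof
      fix v assume v: "v \<in> V"
      then obtain y where y: "y \<in> C" "v = y p i" using V by auto
      have "y p i \<in> F" unfolding F_def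
        using WS_low[OF _ pn i] C(1) y assms[OF v] by blast
      with y(2) unrevealed_value(2)[OF y(1) LS] show "v \<in> F - (\<lambda>q. x q i) ` L" by simp
    qed
  qed
  finally show ?thesis using R unfolding w by (simp add: mult_right_mono)
qed

lemma weight_step_high:
  assumes "\<And>v. v \<in> V \<Longrightarrow> v > kth_point n \<epsilon> i i"
  shows "(\<Sum>v\<in>V. weight (upd x p i v) (insert (p, i) S)) \<le> weight x S"
proof (cases "V = {}")
  case True
  then show ?thesis using weight_ge_1[of x S] by simp
next
  case False
  then obtain y0 where y0: "y0 \<in> C" using V by auto
  have pn: "p \<in> {1..n}" and i: "i \<in> {1..n}" using pi by (auto simp: cells_def)
  define L where "L = high x S i"
  have LS: "L \<subseteq> {q. (q, i) \<in> S}" by (auto simp: L_def high_def)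
  note u = unrevealed_value[OF y0 LS]
  define F where "F = kth_point n \<epsilon> i ` {i<..n}"
  have cF: "card F = n - i"
    unfolding F_def by (subst card_image) (auto intro: inj_on_subset[OF inj_kth_point])
  define R where "R = fact (i - 1 - card (low x S i)) *
    (\<Prod>j\<in>{1..n} - {i}. fact (j - 1 - card (low x S j)) * fact (n - j - card (high x S j)) :: real)"
  have R: "R \<ge> 0" unfolding R_def by (intro mult_nonneg_nonneg prod_nonneg) auto
  have w: "weight x S = fact (n - i - card L) * R"
    using weight_split[OF i] by (simp add: R_def L_def mult_ac)
  have "weight (upd x p i v) (insert (p, i) S) = fact (n - i - card L - 1) * R" if "v \<in> V" for v
    using assms[OF that] u(3,4) pi(2)
    by (subst weight_split[OF i]) (simp add: R_def L_def mult_ac low_upd high_upd)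
  then have "(\<Sum>v\<in>V. weight (upd x p i v) (insert (p, i) S)) = (real (card V) * fact (n - i - card L - 1)) * R"
    by simp
  also have "real (card V) * fact (n - i - card L - 1) \<le> fact (n - i - card L)"
    unfolding cF[symmetric]
  proof (rule card_mult_fact_le)
    show "finite F" by (simp add: F_def)
    show "inj_on (\<lambda>q. x q i) L" by (rule u)
    show "(\<lambda>q. x q i) ` L \<subseteq> F"
    proof
      fix v assume "v \<in> (\<lambda>q. x q i) ` L"
      then obtain q where q: "(q, i) \<in> S" "x q i > kth_point n \<epsilon> i i" "v = x q i"
        by (auto simp: L_def high_def)
      then have "x q i = y0 q i" "q \<in> {1..n}" using agreeD[OF C(2)[OF y0]] S by (auto simp: cells_def)
      with q WS_high[of y0 q i] C(1) y0 i show "v \<in> F" by (auto simp: F_def)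
    qed
    show "V \<subseteq> F - (\<lambda>q. x q i) ` L"
    proof
      fix v assume v: "v \<in> V"
      then obtain y where y: "y \<in> C" "v = y p i" using V by auto
      have "y p i \<in> F" unfolding F_def
        using WS_high[OF _ pn i] C(1) y assms[OF v] by blast
      with y(2) unrevealed_value(2)[OF y(1) LS] show "v \<in> F - (\<lambda>q. x q i) ` L" by simp
    qed
  qed
  finally show ?thesis using R unfolding w by (simp add: mult_right_mono)
qed

text \<open>Only one value is possible, and it changes neither \<open>low\<close> nor
  \<open>high\<close>.\<close>

lemma weight_step_mid:
  assumes "\<And>v. v \<in> V \<Longrightarrow> v = kth_point n \<epsilon> i i"
  shows "(\<Sum>v\<in>V. weight (upd x p i v) (insert (p, i) S)) \<le> weight x S"
proof -
  have "(\<Sum>v\<in>V. weight (upd x p i v) (insert (p, i) S)) = (\<Sum>v\<in>V. weight x S)"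
    using assms pi(2) by (intro sum.cong) (auto simp: weight_def low_upd high_upd)
  also have "\<dots> = real (card V) * weight x S" by simp
  also have "V \<subseteq> {kth_point n \<epsilon> i i}" using assms by auto
  then have "card V \<le> 1" using card_mono[of "{kth_point n \<epsilon> i i}" V] by simp
  then have "real (card V) * weight x S \<le> 1 * weight x S"
    using weight_ge_1[of x S] by (intro mult_right_mono) auto
  finally show ?thesis by simp
qed

end

text \<open>The 3 counts the positions below, at and above the middle point, not the possible
  answers; it becomes the base of the logarithm.\<close>

lemma weight_step:
  assumes "finite C" "C \<subseteq> WS_instances n \<epsilon>" "\<And>y. y \<in> C \<Longrightarrow> agree x S y"
    and "S \<subseteq> cells" "(p, i) \<in> cells" "(p, i) \<notin> S"
  shows "(\<Sum>v\<in>(\<lambda>y. y p i) ` C. weight (upd x p i v) (insert (p, i) S)) \<le> 3 * weight x S"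
proof -
  let ?V = "(\<lambda>y. y p i) ` C" and ?w = "\<lambda>v. weight (upd x p i v) (insert (p, i) S)"
  let ?k = "kth_point n \<epsilon> i i"
  have fin: "finite ?V" using assms(1) by simp
  have "?V = {v\<in>?V. v < ?k} \<union> ({v\<in>?V. v = ?k} \<union> {v\<in>?V. v > ?k})" by auto
  then have "sum ?w ?V = sum ?w ({v\<in>?V. v < ?k} \<union> ({v\<in>?V. v = ?k} \<union> {v\<in>?V. v > ?k}))" by simp
  also have "\<dots> = sum ?w {v\<in>?V. v < ?k} + (sum ?w {v\<in>?V. v = ?k} + sum ?w {v\<in>?V. v > ?k})"
    using fin by (subst sum.union_disjoint; (subst sum.union_disjoint)?) auto
  also have "\<dots> \<le> weight x S + (weight x S + weight x S)"
    by (intro add_mono weight_step_low[OF assms(2-6)] weight_step_mid[OF assms(2-6)]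
        weight_step_high[OF assms(2-6)]) auto
  finally show ?thesis by simp
qed

lemma finite_WS_instances: "finite (WS_instances n \<epsilon>)"
proof -
  have "finite ({1..n} \<rightarrow>\<^sub>E (\<Pi>\<^sub>E i\<in>{1..n}. X n \<epsilon> i))"
    by (intro finite_PiE) (auto simp: X_def)
  then show ?thesis by (rule rev_finite_subset) (auto simp: WS_instances_def)
qed

lemma WS_instances_eqI:
  assumes "x \<in> WS_instances n \<epsilon>" "y \<in> WS_instances n \<epsilon>" "\<And>p i. (p, i) \<in> cells \<Longrightarrow> x p i = y p i"
  shows "x = y"
proof (rule PiE_ext)
  show x: "x \<in> {1..n} \<rightarrow>\<^sub>E (\<Pi>\<^sub>E i\<in>{1..n}. X n \<epsilon> i)" and y: "y \<in> {1..n} \<rightarrow>\<^sub>E (\<Pi>\<^sub>E i\<in>{1..n}. X n \<epsilon> i)"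
    using assms by (auto simp: WS_instances_def)
  fix p assume p: "p \<in> {1..n}"
  show "x p = y p"
  proof (rule PiE_ext)
    show "x p \<in> (\<Pi>\<^sub>E i\<in>{1..n}. X n \<epsilon> i)" "y p \<in> (\<Pi>\<^sub>E i\<in>{1..n}. X n \<epsilon> i)" 
      using x y p by (auto simp del: PiE_iff)
    show "x p i = y p i" if "i \<in> {1..n}" for i using assms(3) p that by (auto simp: cells_def)
  qed
qed

text \<open>Reveal the remaining cells one by one. With \<pi> fixed, only one of the three positions
  occurs at each cell, so the weights of the subclasses add up without the factor 3. Once all cells
  are known, at most one instance is left.\<close>

lemma card_le_weight:
  assumes "C \<subseteq> J_perm n \<epsilon> \<pi>" "\<And>y. y \<in> C \<Longrightarrow> agree x S y" "S \<subseteq> cells"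
  shows "real (card C) \<le> weight x S"
  using assms
proof (induction "card (cells - S)" arbitrary: C x S)
  case 0
  have "finite cells" by (simp add: cells_def)
  with 0 have S: "S = cells" by auto
  have "y = z" if "y \<in> C" "z \<in> C" for y z
  proof (rule WS_instances_eqI)
    show "y \<in> WS_instances n \<epsilon>" "z \<in> WS_instances n \<epsilon>" using that 0(2) J_perm_WS by blast+
    show "y p i = z p i" if "(p, i) \<in> cells" for p i
      using agreeD[OF 0(3)[OF \<open>y \<in> C\<close>]] agreeD[OF 0(3)[OF \<open>z \<in> C\<close>]] that by (simp add: S)
  qed
  then have "card C \<le> 1" by (metis One_nat_def card_le_Suc0_iff_eq card.infinite le0)
  then show ?case using weight_ge_1[of x S] by linarith
next
  case (Suc m)
  have fc: "finite cells" by (simp add: cells_def)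
  from Suc(2) have "cells - S \<noteq> {}" by force
  then obtain p i where pi: "(p, i) \<in> cells" "(p, i) \<notin> S" by auto
  have CW: "C \<subseteq> WS_instances n \<epsilon>" using Suc(3) J_perm_WS by blast
  then have fC: "finite C" using finite_WS_instances finite_subset by blast
  let ?V = "(\<lambda>y. y p i) ` C"
  have "Suc (card (cells - insert (p, i) S)) = card (cells - S)"
    unfolding Diff_insert[of cells] using pi fc by (intro card_Suc_Diff1) auto
  then have m: "m = card (cells - insert (p, i) S)" using Suc(2) by simp
  have "real (card C) = (\<Sum>v\<in>?V. real (card {y\<in>C. y p i = v}))"
    using sum.image_gen[OF fC, of "\<lambda>_. 1 :: real" "\<lambda>y. y p i"] by simp
  also have "\<dots> \<le> (\<Sum>v\<in>?V. weight (upd x p i v) (insert (p, i) S))"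
  proof (rule sum_mono)
    fix v
    show "real (card {y\<in>C. y p i = v}) \<le> weight (upd x p i v) (insert (p, i) S)"
      using Suc(3-5) pi by (intro Suc(1)[OF m]) (auto intro: agree_upd)
  qed
  also have "\<dots> \<le> weight x S"
  proof -
    have pn: "p \<in> {1..n}" and i: "i \<in> {1..n}" using pi by (auto simp: cells_def)
    note D = J_permD[OF subsetD[OF Suc(3)] pn i]
    note step = CW Suc(4,5) pi order_refl
    consider "\<pi> p < i" | "\<pi> p = i" | "\<pi> p > i" by linarith
    then show ?thesis
    proof cases
      case 1
      then show ?thesis using D(2) by (intro weight_step_low[OF step]) auto
    next
      case 2
      then show ?thesis using D(1) by (intro weight_step_mid[OF step]) auto
    next
      case 3
      then show ?thesis using D(3) by (intro weight_step_high[OF step]) auto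
    qed
  qed
  finally show ?case .
qed

end

section \<open>Kraft inequality for protocols\<close>

lemma next_action_persists:
  assumes "next_action \<mu> P k = Allocate A" "k \<le> m"
  shows "next_action \<mu> P m = Allocate A"
  using assms(2)
proof (induction m rule: dec_induct)
  case (step m)
  then have "transcript \<mu> P (Suc m) = transcript \<mu> P m"
    by (simp add: next_action_def Let_def)
  with step show ?case by (simp add: next_action_def)
qed (use assms in simp)

lemma num_queries_le: "next_action \<mu> P k = Allocate A \<Longrightarrow> num_queries \<mu> P \<le> k"
  unfolding num_queries_def by (rule Least_le) blast

lemma num_queries_gt:
  assumes "terminates_on \<mu> P" "next_action \<mu> P k = Query q"
  shows "k < num_queries \<mu> P"
proof (rule ccontr)
  assume *: "\<not> k < num_queries \<mu> P"
  obtain A where "next_action \<mu> P (num_queries \<mu> P) = Allocate A"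
    using LeastI_ex[OF assms(1)[unfolded terminates_on_def]] unfolding num_queries_def by blast
  from next_action_persists[OF this, of k] * assms(2) show False by simp
qed

lemma transcript_Suc:
  assumes "next_action \<mu> P k = Query q"
  shows "transcript \<mu> P (Suc k) = transcript \<mu> P k @ [(q, answer \<mu> q)]"
  using assms by (simp add: next_action_def Let_def)

context ws_parameters
begin

context
  fixes P :: protocol
  assumes valid: "\<And>x. x \<in> J n \<epsilon> \<Longrightarrow> valid_on n (WS_measure n \<epsilon> x) P"
    and cuts: "\<And>x. x \<in> J n \<epsilon> \<Longrightarrow> cuts_only_on (WS_measure n \<epsilon> x) P"
    and prim: "\<And>x. x \<in> J n \<epsilon> \<Longrightarrow> primitive_on n (WS_measure n \<epsilon> x) P"
    and fair: "\<And>x. x \<in> J n \<epsilon> \<Longrightarrow> fair_on n (WS_measure n \<epsilon> x) P"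
begin

lemma query_is_cell:
  assumes "x \<in> J n \<epsilon>" "next_action (WS_measure n \<epsilon> x) P k = Query q"
  shows "\<exists>p i. (p, i) \<in> cells \<and> q = Cut p (real i / real n)"
proof (cases q)
  case (Cut p \<alpha>)
  with prim[OF assms(1)] assms(2) obtain i where "i \<in> {1..n}" "\<alpha> = real i / real n"
    unfolding primitive_on_def by blast
  moreover have "p \<in> {1..n}"
    using valid[OF assms(1)] assms(2) Cut unfolding valid_on_def by (metis legal_action.simps(1))
  ultimately show ?thesis using Cut by (auto simp: cells_def)
next
  case (Eval p z)
  then show ?thesis using cuts[OF assms(1)] assms(2) by (auto simp: cuts_only_on_def)
qed

lemma answer_cell:
  assumes "x \<in> J n \<epsilon>" "(p, i) \<in> cells"
  shows "answer (WS_measure n \<epsilon> x) (Cut p (real i / real n)) = x p i"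
  using assms by (intro answer_WS J_WS) (auto simp: cells_def)

lemma cut_values_in_grid:
  assumes x: "x \<in> J n \<epsilon>"
  shows "cut_values (transcript (WS_measure n \<epsilon> x) P k) \<subseteq> grid"
proof (induction k)
  case 0 then show ?case by (simp add: cut_values_def)
next
  case (Suc k)
  show ?case
  proof (cases "next_action (WS_measure n \<epsilon> x) P k")
    case (Query q)
    then obtain p i where pi: "(p, i) \<in> cells" "q = Cut p (real i / real n)"
      using query_is_cell[OF x] by blast
    have "x p i \<in> grid" using pi by (intro WS_in_grid J_WS x) (auto simp: cells_def)
    moreover have "transcript (WS_measure n \<epsilon> x) P (Suc k) = transcript (WS_measure n \<epsilon> x) P k @ [(q, x p i)]"
      using transcript_Suc[OF Query] answer_cell[OF x pi(1)] pi(2) by simp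
    ultimately show ?thesis using Suc by (auto simp: cut_values_def)
  next
    case (Allocate A)
    then show ?thesis using Suc by (simp add: next_action_def)
  qed
qed

lemma allocation_legal:
  assumes x: "x \<in> J n \<epsilon>" and A: "next_action (WS_measure n \<epsilon> x) P k = Allocate A"
  shows "p \<in> {1..n} \<Longrightarrow> fst (A p) \<in> grid \<and> snd (A p) \<in> grid"
    and "disjoint_family_on (interval_of A) {1..n}"
    and "p \<in> {1..n} \<Longrightarrow> 1 / real n \<le> measure (WS_measure n \<epsilon> x p) (interval_of A p)"
proof -
  have "legal_action n (transcript (WS_measure n \<epsilon> x) P k) (Allocate A)"
    using valid[OF x] A unfolding valid_on_def by metis
  moreover have "{0, 1} \<union> cut_values (transcript (WS_measure n \<epsilon> x) P k) \<subseteq> grid"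
    using cut_values_in_grid[OF x, of k] zero_one_in_grid by simp
  ultimately show "p \<in> {1..n} \<Longrightarrow> fst (A p) \<in> grid \<and> snd (A p) \<in> grid"
    and "disjoint_family_on (interval_of A) {1..n}"
    unfolding legal_action.simps by blast+
  obtain k' A' where A': "next_action (WS_measure n \<epsilon> x) P k' = Allocate A'"
    "\<forall>p\<in>{1..n}. measure (WS_measure n \<epsilon> x p) (interval_of A' p) \<ge> 1 / real n"
    using fair[OF x] unfolding fair_on_def by blast
  \<comment> \<open>Fairness is asserted at some allocating step; allocations persist, so it is the
    same allocation at the later of the two steps.\<close>
  have "Allocate A = Allocate A'"
    using next_action_persists[OF A, of "max k k'"] next_action_persists[OF A'(1), of "max k k'"] by simp
  then show "p \<in> {1..n} \<Longrightarrow> 1 / real n \<le> measure (WS_measure n \<epsilon> x p) (interval_of A p)"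
    using A'(2) by simp
qed

text \<open>One allocation is fair on the whole class, so the class lies within a single
  \<open>J_perm\<close>.\<close>

lemma allocated_class_card_le_weight:
  assumes C: "C \<subseteq> J n \<epsilon>" "\<And>y. y \<in> C \<Longrightarrow> next_action (WS_measure n \<epsilon> y) P k = Allocate A"
    and S: "\<And>y. y \<in> C \<Longrightarrow> agree x S y" "S \<subseteq> cells"
  shows "real (card C) \<le> weight x S"
proof (cases "C = {}")
  case True
  then show ?thesis using weight_ge_1[of x S] by simp
next
  case False
  then obtain y where y: "y \<in> C" by blast
  then obtain \<pi> where \<pi>: "y \<in> J_perm n \<epsilon> \<pi>" "\<pi> permutes {1..n}"
    using C(1) by (auto simp: J_def)
  have "C \<subseteq> J_perm n \<epsilon> \<pi>"
  proof
    fix z assume z: "z \<in> C"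
    then obtain \<rho> where \<rho>: "z \<in> J_perm n \<epsilon> \<rho>" "\<rho> permutes {1..n}"
      using C(1) by (auto simp: J_def)
    note ay = allocation_legal[OF subsetD[OF C(1) y] C(2)[OF y]]
    note az = allocation_legal[OF subsetD[OF C(1) z] C(2)[OF z]]
    have "\<pi> = \<rho>"
      by (rule fair_allocation_unique_permutation[OF \<pi> \<rho> ay(1,2,3) az(3)])
    with \<rho> show "z \<in> J_perm n \<epsilon> \<pi>" by simp
  qed
  then show ?thesis using S by (intro card_le_weight)
qed

text \<open>Each query splits the class into a part with \<open>\<pi> p < i\<close>, one with
  \<open>\<pi> p = i\<close> and one with \<open>\<pi> p > i\<close>, and the weights of the answers in each part add up to at most
  the weight of the class.\<close>

lemma kraft_inequality:
  assumes "C \<subseteq> J n \<epsilon>" "\<And>y. y \<in> C \<Longrightarrow> transcript (WS_measure n \<epsilon> y) P k = h"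
    and "\<And>y. y \<in> C \<Longrightarrow> agree x S y" "S \<subseteq> cells"
    and "\<And>y. y \<in> C \<Longrightarrow> num_queries (WS_measure n \<epsilon> y) P \<le> k + m"
  shows "(\<Sum>y\<in>C. (1 / 3) ^ (num_queries (WS_measure n \<epsilon> y) P - k)) \<le> weight x S"
  using assms
proof (induction m arbitrary: C k h x S)
  case (0 C k h x S)
  show ?case
  proof (cases "P (map snd h)")
    case (Query q)
    \<comment> \<open>A pending query would exceed the bound k on the number of queries, so no
      instance reaches this case.\<close>
    have "C = {}"
    proof (rule ccontr)
      assume "C \<noteq> {}"
      then obtain y where y: "y \<in> C" by blast
      then have "next_action (WS_measure n \<epsilon> y) P k = Query q"
        using 0(2) Query by (simp add: next_action_def)
      from num_queries_gt[OF _ this] valid[of y] 0(1,5) y show False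
        by (force simp: valid_on_def)
    qed
    then show ?thesis using weight_ge_1[of x S] by simp
  next
    case (Allocate A)
    then have "real (card C) \<le> weight x S"
      using 0 by (intro allocated_class_card_le_weight[of C k A]) (auto simp: next_action_def)
    moreover have "num_queries (WS_measure n \<epsilon> y) P - k = 0" if "y \<in> C" for y
      using 0(5)[OF that] by simp
    ultimately show ?thesis by simp
  qed
next
  case (Suc m C k h x S)
  show ?case
  proof (cases "P (map snd h)")
    case (Allocate A)
    then have na: "next_action (WS_measure n \<epsilon> y) P k = Allocate A" if "y \<in> C" for y
      using Suc(3) that by (simp add: next_action_def)
    have "real (card C) \<le> weight x S"
      using Suc(2,4,5) na by (intro allocated_class_card_le_weight[of C k A]) auto
    moreover have "num_queries (WS_measure n \<epsilon> y) P - k = 0" if "y \<in> C" for y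
      using num_queries_le[OF na[OF that]] by simp
    ultimately show ?thesis by simp
  next
    case (Query q)
    let ?d = "\<lambda>y. num_queries (WS_measure n \<epsilon> y) P"
    have na: "next_action (WS_measure n \<epsilon> y) P k = Query q" if "y \<in> C" for y
      using Suc(3) that Query by (simp add: next_action_def)
    have gt: "k < ?d y" if "y \<in> C" for y
      using num_queries_gt[OF _ na[OF that]] valid[of y] Suc(2) that by (auto simp: valid_on_def)
    have CW: "C \<subseteq> WS_instances n \<epsilon>" using Suc(2) J_WS by blast
    then have fC: "finite C" using finite_WS_instances finite_subset by blast
    \<comment> \<open>The query just asked contributes one factor 1/3, which will cancel the 3 of
      \<open>weight_step\<close>.\<close>
    have third: "(\<Sum>y\<in>B. (1 / 3) ^ (?d y - k)) = (\<Sum>y\<in>B. (1 / 3) ^ (?d y - Suc k)) / (3 :: real)"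
      if "B \<subseteq> C" for B
      unfolding sum_divide_distrib
    proof (rule sum.cong)
      fix y assume "y \<in> B"
      then have "?d y - k = Suc (?d y - Suc k)" using gt that by fastforce
      then show "(1 / 3) ^ (?d y - k) = (1 / 3) ^ (?d y - Suc k) / (3 :: real)" by simp
    qed simp
    show ?thesis
    proof (cases "C = {}")
      case True
      then show ?thesis using weight_ge_1[of x S] by simp
    next
      case False
      then obtain y0 where y0: "y0 \<in> C" by blast
      then have "y0 \<in> J n \<epsilon>" using Suc(2) by blast
      from query_is_cell[OF this na[OF y0]]
      obtain p i where pi: "(p, i) \<in> cells" "q = Cut p (real i / real n)" by blast
      have tr: "transcript (WS_measure n \<epsilon> y) P (Suc k) = h @ [(q, y p i)]" if "y \<in> C" for y
        using transcript_Suc[OF na[OF that]] answer_cell[OF subsetD[OF Suc(2) that] pi(1)] Suc(3)[OF that] pi(2)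
        by simp
      have part: "(\<Sum>y\<in>B. (1 / 3) ^ (?d y - Suc k)) \<le> weight z T"
        if B: "B \<subseteq> C" "\<And>y. y \<in> B \<Longrightarrow> y p i = v" "\<And>y. y \<in> B \<Longrightarrow> agree z T y" "T \<subseteq> cells" for B v z T
      proof (rule Suc.IH[of B "Suc k" "h @ [(q, v)]"])
        show "B \<subseteq> J n \<epsilon>" using B(1) Suc(2) by blast
        show "transcript (WS_measure n \<epsilon> y) P (Suc k) = h @ [(q, v)]" if "y \<in> B" for y
          using tr[of y] B(1,2) that by auto
        show "?d y \<le> Suc k + m" if "y \<in> B" for y
          using Suc(6)[of y] B(1) that by auto
      qed (use B in auto)
      have "(\<Sum>y\<in>C. (1 / 3) ^ (?d y - Suc k)) \<le> 3 * weight x S"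
      proof (cases "(p, i) \<in> S")
        case True
        \<comment> \<open>A repeated query has a known answer: the class does not split and the
          carrier stays the same.\<close>
        have "(\<Sum>y\<in>C. (1 / 3) ^ (?d y - Suc k)) \<le> weight x S"
          using Suc(4,5) agreeD[OF Suc(4) True] by (intro part[of C "x p i"]) auto
        then show ?thesis using weight_ge_1[of x S] by simp
      next
        case False
        have "(\<Sum>y\<in>C. (1 / 3 :: real) ^ (?d y - Suc k)) =
            (\<Sum>v\<in>(\<lambda>y. y p i) ` C. \<Sum>y\<in>{y\<in>C. y p i = v}. (1 / 3) ^ (?d y - Suc k))"
          by (rule sum.image_gen[OF fC])
        also have "\<dots> \<le> (\<Sum>v\<in>(\<lambda>y. y p i) ` C. weight (upd x p i v) (insert (p, i) S))"
          using Suc(4,5) pi(1) by (intro sum_mono part) (auto intro: agree_upd)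
        also have "\<dots> \<le> 3 * weight x S"
          by (rule weight_step[OF fC CW Suc(4,5) pi(1) False])
        finally show ?thesis .
      qed
      then show ?thesis using third[of C] by simp
    qed
  qed
qed

end

end

section \<open>Number of instances and expected number of queries\<close>

text \<open>Pair the factor k with n + 1 - k: their product is n + (k-1)(n-k) \<ge> n.\<close>

lemma fact_squared_ge: "real n ^ n \<le> (fact n)\<^sup>2"
proof -
  have f: "fact n = (\<Prod>k=1..n. real k)"
    by (simp add: fact_prod)
  have "(fact n :: real)\<^sup>2 = (\<Prod>k=1..n. real k) * (\<Prod>k=1..n. real (n + 1 - k))"
    unfolding power2_eq_square f by (subst (2) prod.atLeastAtMost_rev) simp
  also have "\<dots> = (\<Prod>k=1..n. real k * real (n + 1 - k))" by (simp add: prod.distrib)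
  also have "\<dots> \<ge> (\<Prod>k=1..n. real n)"
  proof (intro prod_mono conjI)
    fix k assume k: "k \<in> {1..n}"
    then have "real k * real (n + 1 - k) = real n + (real k - 1) * (real n - real k)"
      by (simp add: of_nat_diff algebra_simps)
    also have "\<dots> \<ge> real n" using k by simp
    finally show "real n \<le> real k * real (n + 1 - k)" .
  qed simp
  finally show ?thesis by simp
qed

lemma ln_fact_ge:
  assumes "n > 0"
  shows "real n * ln (real n) \<le> 2 * ln (fact n)"
proof -
  have "ln (real n ^ n) \<le> ln ((fact n)\<^sup>2)"
    using assms fact_squared_ge by (subst ln_le_cancel_iff) auto
  then show ?thesis using assms by (simp add: ln_realpow)
qed

context ws_parameters
begin

section \<open>Lower bound for the number of instances\<close>

lemma finite_J: "finite (J n \<epsilon>)"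
  by (rule finite_subset[OF _ finite_WS_instances]) (auto simp: J_def J_perm_def)

text \<open>In group i the rank of p is \<pi> p, shuffled separately below and above i by the two
  components of \<open>s i\<close>, with i itself fixed.\<close>

definition perm_instance :: "(nat \<Rightarrow> nat) \<times> (nat \<Rightarrow> (nat \<Rightarrow> nat) \<times> (nat \<Rightarrow> nat)) \<Rightarrow> nat \<Rightarrow> nat \<Rightarrow> real" where
  "perm_instance = (\<lambda>(\<pi>, s). \<lambda>p\<in>{1..n}. \<lambda>i\<in>{1..n}. kth_point n \<epsilon> i (fst (s i) (snd (s i) (\<pi> p))))"

definition perm_families :: "((nat \<Rightarrow> nat) \<times> (nat \<Rightarrow> (nat \<Rightarrow> nat) \<times> (nat \<Rightarrow> nat))) set" where
  "perm_families = {\<pi>. \<pi> permutes {1..n}} \<times>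
     (\<Pi>\<^sub>E i\<in>{1..n}. {f. f permutes {1..<i}} \<times> {g. g permutes {i<..n}})"

lemma card_perm_families: "real (card perm_families) = fact n * weight x {}"
proof -
  have "card {\<pi>. \<pi> permutes {1..n}} = fact n"
    using card_permutations[of "{1..n}" n] by simp
  moreover have "card ({f. f permutes {1..<i}} \<times> {g. g permutes {i<..n}}) = fact (i - 1) * fact (n - i)" for i
    using card_permutations[of "{1..<i}" "i - 1"] card_permutations[of "{i<..n}" "n - i"]
    by (simp add: card_cartesian_product)
  ultimately show ?thesis
    by (simp add: perm_families_def card_cartesian_product card_PiE weight_def low_def high_def)
qed

lemma two_sided_permutation:
  assumes "i \<in> {1..n}" "f permutes {1..<i}" "g permutes {i<..n}"
  shows "q < i \<Longrightarrow> f (g q) = f q" "f (g i) = i" "q > i \<Longrightarrow> f (g q) = g q"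
    "q < i \<Longrightarrow> q \<ge> 1 \<Longrightarrow> f (g q) \<in> {1..i - 1}"
    "q > i \<Longrightarrow> q \<le> n \<Longrightarrow> f (g q) \<in> {i + 1..n}"
    "bij_betw (\<lambda>q. f (g q)) {1..n} {1..n}"
proof -
  have g: "g q = q" if "\<not> i < q" for q using that assms(3) by (simp add: permutes_def)
  have f: "f q = q" if "\<not> q < i" for q using that assms(2) by (simp add: permutes_def)
  have gi: "i < q \<Longrightarrow> q \<le> n \<Longrightarrow> i < g q \<and> g q \<le> n" for q
    using permutes_in_image[OF assms(3), of q] by simp
  have gi': "i < q \<Longrightarrow> \<not> g q < i" for q
    using gi[of q] assms(3) by (cases "q \<le> n") (auto simp: permutes_def)
  show 1: "q < i \<Longrightarrow> f (g q) = f q" and "f (g i) = i" and 3: "q > i \<Longrightarrow> f (g q) = g q"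
    using f g gi' by auto
  show "q < i \<Longrightarrow> q \<ge> 1 \<Longrightarrow> f (g q) \<in> {1..i - 1}"
    using 1 permutes_in_image[OF assms(2), of q] by auto
  show "q > i \<Longrightarrow> q \<le> n \<Longrightarrow> f (g q) \<in> {i + 1..n}"
    using 3 gi[of q] by (simp add: Suc_le_eq)
  have "f permutes {1..n}" "g permutes {1..n}"
    using assms by (auto intro: permutes_subset)
  then have "(f \<circ> g) permutes {1..n}" using permutes_compose by blast
  from permutes_imp_bij[OF this] show "bij_betw (\<lambda>q. f (g q)) {1..n} {1..n}"
    by (simp add: comp_def)
qed

lemma perm_instance_in_J_perm:
  assumes "(\<pi>, s) \<in> perm_families"
  shows "perm_instance (\<pi>, s) \<in> J_perm n \<epsilon> \<pi>"
proof -
  have \<pi>: "\<pi> permutes {1..n}"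
    and s: "\<And>i. i \<in> {1..n} \<Longrightarrow> fst (s i) permutes {1..<i}" "\<And>i. i \<in> {1..n} \<Longrightarrow> snd (s i) permutes {i<..n}"
    using assms by (auto simp: perm_families_def PiE_iff mem_Times_iff)
  define x where "x = perm_instance (\<pi>, s)"
  have x: "x p i = kth_point n \<epsilon> i (fst (s i) (snd (s i) (\<pi> p)))" if "p \<in> {1..n}" "i \<in> {1..n}" for p i
    using that by (simp add: x_def perm_instance_def)
  have \<pi>p: "\<pi> p \<in> {1..n}" if "p \<in> {1..n}" for p
    using permutes_in_image[OF \<pi>, of p] that by simp
  have bij: "bij_betw (\<lambda>p. x p i) {1..n} (X n \<epsilon> i)" if i: "i \<in> {1..n}" for i
  proof -
    have "bij_betw (kth_point n \<epsilon> i) {1..n} (X n \<epsilon> i)"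
      unfolding X_def by (intro inj_on_imp_bij_betw inj_on_subset[OF inj_kth_point]) auto
    from bij_betw_trans[OF bij_betw_trans[OF permutes_imp_bij[OF \<pi>] two_sided_permutation(6)[OF i s(1)[OF i] s(2)[OF i]]] this]
    have "bij_betw (\<lambda>p. kth_point n \<epsilon> i (fst (s i) (snd (s i) (\<pi> p)))) {1..n} (X n \<epsilon> i)"
      by (simp add: comp_def)
    also have "?this \<longleftrightarrow> ?thesis" by (intro bij_betw_cong) (simp add: x[OF _ i])
    finally show ?thesis .
  qed
  have "x \<in> {1..n} \<rightarrow>\<^sub>E (\<Pi>\<^sub>E i\<in>{1..n}. X n \<epsilon> i)"
  proof -
    have "x p i \<in> X n \<epsilon> i" if "p \<in> {1..n}" "i \<in> {1..n}" for p i
      using bij_betwE[OF bij[OF that(2)]] that(1) by blast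
    moreover have "x \<in> extensional {1..n}" "\<And>p. p \<in> {1..n} \<Longrightarrow> x p \<in> extensional {1..n}"
      by (auto simp: x_def perm_instance_def)
    ultimately show ?thesis by (simp add: PiE_iff)
  qed
  with bij have "x \<in> WS_instances n \<epsilon>" by (simp add: WS_instances_def)
  moreover have "(\<pi> p = i \<longrightarrow> x p i = kth_point n \<epsilon> i i) \<and>
        (\<pi> p < i \<longrightarrow> x p i \<in> kth_point n \<epsilon> i ` {1..i - 1}) \<and>
        (\<pi> p > i \<longrightarrow> x p i \<in> kth_point n \<epsilon> i ` {i + 1..n})"
    if p: "p \<in> {1..n}" and i: "i \<in> {1..n}" for p i
  proof -
    note t = two_sided_permutation[OF i s(1)[OF i] s(2)[OF i]]
    show ?thesis
      unfolding x[OF p i] using t(2) t(4,5)[of "\<pi> p"] \<pi>p[OF p]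
      by (auto simp del: atLeastAtMost_iff intro!: imageI simp: atLeastAtMost_iff[of "\<pi> p"])
  qed
  ultimately show ?thesis by (simp add: J_perm_def x_def)
qed

text \<open>First \<pi> is recovered from the groups in which each player holds the middle point.
  Group i then yields the composed shuffle, and its two components have disjoint supports.\<close>

lemma inj_on_perm_instance: "inj_on perm_instance perm_families"
proof (rule inj_onI)
  fix a b assume ab: "a \<in> perm_families" "b \<in> perm_families" "perm_instance a = perm_instance b"
  obtain \<pi> s \<rho> t where [simp]: "a = (\<pi>, s)" "b = (\<rho>, t)" by fastforce
  have \<pi>: "\<pi> permutes {1..n}" and \<rho>: "\<rho> permutes {1..n}"
    and s: "s \<in> extensional {1..n}" and t: "t \<in> extensional {1..n}"
    and s1: "\<And>i. i \<in> {1..n} \<Longrightarrow> fst (s i) permutes {1..<i}" and s2: "\<And>i. i \<in> {1..n} \<Longrightarrow> snd (s i) permutes {i<..n}"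
    and t1: "\<And>i. i \<in> {1..n} \<Longrightarrow> fst (t i) permutes {1..<i}" and t2: "\<And>i. i \<in> {1..n} \<Longrightarrow> snd (t i) permutes {i<..n}"
    using ab(1,2) by (auto simp: perm_families_def PiE_iff mem_Times_iff)
  note xa = perm_instance_in_J_perm[OF ab(1)[simplified]] and xb = perm_instance_in_J_perm[OF ab(2)[simplified]]
  have "\<pi> p = \<rho> p" for p
  proof (cases "p \<in> {1..n}")
    case True
    then have i: "\<pi> p \<in> {1..n}" using permutes_in_image[OF \<pi>, of p] by simp
    have "perm_instance (\<pi>, s) p (\<pi> p) = kth_point n \<epsilon> (\<pi> p) (\<pi> p)"
      using J_permD(1)[OF xa True i] by simp
    then show ?thesis using J_permD(1)[OF xb True i] ab(3) by simp
  qed (use \<pi> \<rho> in \<open>simp add: permutes_def\<close>)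
  then have eq: "\<pi> = \<rho>" by blast
  have "s i = t i" if i: "i \<in> {1..n}" for i
  proof -
    note S = two_sided_permutation[OF i s1[OF i] s2[OF i]]
    note T = two_sided_permutation[OF i t1[OF i] t2[OF i]]
    have comp: "fst (s i) (snd (s i) q) = fst (t i) (snd (t i) q)" if q: "q \<in> {1..n}" for q
    proof -
      obtain p where p: "p \<in> {1..n}" "\<pi> p = q"
        using permutes_image[OF \<pi>] q by (metis imageE)
      have "perm_instance (\<pi>, s) p i = perm_instance (\<pi>, t) p i" using ab(3) eq by simp
      then have "kth_point n \<epsilon> i (fst (s i) (snd (s i) q)) = kth_point n \<epsilon> i (fst (t i) (snd (t i) q))"
        using p i by (simp add: perm_instance_def)
      then show ?thesis using inj_kth_point by (auto dest: injD)
    qed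
    have "fst (s i) q = fst (t i) q" for q
    proof (cases "q \<in> {1..<i}")
      case True
      with i have "q \<in> {1..n}" "q < i" by auto
      with comp[of q] S(1)[of q] T(1)[of q] show ?thesis by simp
    next
      case False
      then show ?thesis using s1[OF i] t1[OF i] unfolding permutes_def by metis
    qed
    moreover have "snd (s i) q = snd (t i) q" for q
    proof (cases "q \<in> {i<..n}")
      case True
      with i have "q \<in> {1..n}" "q > i" by auto
      with comp[of q] S(3)[of q] T(3)[of q] show ?thesis by simp
    next
      case False
      then show ?thesis using s2[OF i] t2[OF i] unfolding permutes_def by metis
    qed
    ultimately show ?thesis by (intro prod_eqI ext)
  qed
  then have "s = t" using s t by (intro extensionalityI)
  with eq show "a = b" by simp
qed

lemma card_J_ge: "fact n * weight x {} \<le> real (card (J n \<epsilon>))"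
proof -
  have "perm_instance ` perm_families \<subseteq> J n \<epsilon>"
    using perm_instance_in_J_perm by (auto simp: J_def perm_families_def)
  then have "card (perm_instance ` perm_families) \<le> card (J n \<epsilon>)"
    by (intro card_mono finite_J)
  then show ?thesis using card_perm_families[of x] card_image[OF inj_on_perm_instance] by simp
qed

text \<open>Divided by the number of instances, the Kraft sum says that the mean of 3^(-d) is at
  most 1/n!; convexity turns this into a bound on the mean of d.\<close>

lemma expected_queries_ge:
  fixes P :: protocol
  assumes P: "\<And>x. x \<in> J n \<epsilon> \<Longrightarrow> valid_on n (WS_measure n \<epsilon> x) P"
    "\<And>x. x \<in> J n \<epsilon> \<Longrightarrow> cuts_only_on (WS_measure n \<epsilon> x) P"
    "\<And>x. x \<in> J n \<epsilon> \<Longrightarrow> primitive_on n (WS_measure n \<epsilon> x) P"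
    "\<And>x. x \<in> J n \<epsilon> \<Longrightarrow> fair_on n (WS_measure n \<epsilon> x) P"
  shows "ln (fact n) / ln 3 \<le>
    measure_pmf.expectation (D n \<epsilon>) (\<lambda>x. real (num_queries (WS_measure n \<epsilon> x) P))"
proof -
  define d where "d = (\<lambda>x. num_queries (WS_measure n \<epsilon> x) P)"
  define K where "K = weight (\<lambda>_ _. 0) {}"
  define t :: real where "t = ln (fact n)"
  define N where "N = real (card (J n \<epsilon>))"
  have K: "K \<ge> 1" by (simp add: K_def weight_ge_1)
  have N: "fact n * K \<le> N" using card_J_ge by (simp add: K_def N_def)
  have "(0::real) < fact n * K" using K by simp
  with N have N0: "N > 0" by linarith
  have "(\<Sum>y\<in>J n \<epsilon>. (1 / 3) ^ (d y - 0)) \<le> K"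
    unfolding d_def K_def
    \<comment> \<open>Finiteness of \<open>J\<close> supplies the uniform depth bound for the
      induction.\<close>
    by (rule kraft_inequality[OF P, where h = "[]" and m = "Max (d ` J n \<epsilon>)"])
       (auto simp: agree_def d_def finite_J)
  then have kraft: "(\<Sum>y\<in>J n \<epsilon>. (1 / 3) ^ d y) \<le> K" by simp
  \<comment> \<open>Jensen's inequality for \<open>exp\<close>, via its tangent at \<open>- ln (n!)\<close>\<close>
  have tangent: "exp (- t) * (1 + t - real (d y) * ln 3) \<le> (1 / 3) ^ d y" for y
  proof -
    have "exp (- t) * (1 + t - real (d y) * ln 3) \<le> exp (- t) * exp (t - real (d y) * ln 3)"
      using exp_ge_add_one_self[of "t - real (d y) * ln 3"]
      by (intro mult_left_mono) (simp_all only: add_diff_eq exp_ge_zero)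
    also have "\<dots> = exp (real (d y) * (- ln 3))" by (simp add: exp_add[symmetric])
    also have "\<dots> = (exp (- ln 3)) ^ d y" by (rule exp_of_nat_mult)
    also have "\<dots> = (1 / 3) ^ d y" by (simp add: exp_minus inverse_eq_divide)
    finally show ?thesis .
  qed
  have "exp (- t) * (N * (1 + t) - ln 3 * (\<Sum>y\<in>J n \<epsilon>. real (d y)))
      = (\<Sum>y\<in>J n \<epsilon>. exp (- t) * (1 + t - real (d y) * ln 3))"
    by (simp add: sum_distrib_left[symmetric] sum_subtractf sum_distrib_right[symmetric] N_def mult.commute)
  also have "\<dots> \<le> (\<Sum>y\<in>J n \<epsilon>. (1 / 3) ^ d y)" by (intro sum_mono tangent)
  also note kraft
  also have "K \<le> exp (- t) * N" using N by (simp add: t_def exp_minus field_simps)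
  finally have "N * (1 + t) - ln 3 * (\<Sum>y\<in>J n \<epsilon>. real (d y)) \<le> N" by simp
  then have "N * t \<le> ln 3 * (\<Sum>y\<in>J n \<epsilon>. real (d y))" by (simp add: algebra_simps)
  then have "t / ln 3 \<le> (\<Sum>y\<in>J n \<epsilon>. real (d y)) / N"
    using N0 by (simp add: field_simps)
  also have "\<dots> = measure_pmf.expectation (D n \<epsilon>) (\<lambda>x. real (d x))"
    unfolding D_def N_def using finite_J N0
    by (subst integral_pmf_of_set) (auto simp: N_def)
  finally show ?thesis by (simp add: t_def d_def)
qed

end

theorem theorem1:
  "\<exists>c>0. \<forall>n\<ge>2. \<forall>\<epsilon>. 0 < \<epsilon> \<and> \<epsilon> < 1 / real n ^ 4 \<longrightarrow>
     (\<forall>P :: protocol.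
        (\<forall>x \<in> J n \<epsilon>. valid_on n (WS_measure n \<epsilon> x) P \<and>
                      cuts_only_on (WS_measure n \<epsilon> x) P \<and>
                      primitive_on n (WS_measure n \<epsilon> x) P \<and>
                      fair_on n (WS_measure n \<epsilon> x) P) \<longrightarrow>
        measure_pmf.expectation (D n \<epsilon>) (\<lambda>x. real (num_queries (WS_measure n \<epsilon> x) P))
          \<ge> c * real n * ln (real n))"
proof (intro exI[of _ "1 / (2 * ln 3)"] conjI allI impI)
  \<comment> \<open>The ln 3 comes from the threefold branching, the 2 from n^n \<le>
    (n!)^2.\<close>
  show "0 < 1 / (2 * ln 3 :: real)" by simp
  fix n :: nat and \<epsilon> :: real and P :: protocol
  assume n: "n \<ge> 2" and \<epsilon>: "0 < \<epsilon> \<and> \<epsilon> < 1 / real n ^ 4"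
    and P: "\<forall>x \<in> J n \<epsilon>. valid_on n (WS_measure n \<epsilon> x) P \<and>
                      cuts_only_on (WS_measure n \<epsilon> x) P \<and>
                      primitive_on n (WS_measure n \<epsilon> x) P \<and>
                      fair_on n (WS_measure n \<epsilon> x) P"
  interpret ws_parameters n \<epsilon> using n \<epsilon> by unfold_locales auto
  have "1 / (2 * ln 3) * real n * ln (real n) = (real n * ln (real n)) / (2 * ln 3)" by simp
  also have "\<dots> \<le> (2 * ln (fact n)) / (2 * ln 3)"
    using ln_fact_ge[of n] n by (intro divide_right_mono) auto
  also have "\<dots> = ln (fact n) / ln 3" by simp
  also have "\<dots> \<le> measure_pmf.expectation (D n \<epsilon>) (\<lambda>x. real (num_queries (WS_measure n \<epsilon> x) P))"
    using P by (intro expected_queries_ge) auto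
  finally show "measure_pmf.expectation (D n \<epsilon>) (\<lambda>x. real (num_queries (WS_measure n \<epsilon> x) P))
          \<ge> 1 / (2 * ln 3) * real n * ln (real n)" .
qed

end
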